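(* Assume that $\phi$ is a function on $\mathbb{T}$, not identically zero, of the form $\phi=P_{\sqrt{2/3}}*\mu$ for a positive Radon measure $\mu$ on $\mathbb{T}$. Then for any $f\in H_0^2(\mathbb{T})$, $$\left\|\frac{P_{1/\sqrt2}*H_\phi(f)}{\sqrt{P_{1/\sqrt2}*\phi}}\right\|_{L^\infty(\mathbb{T})}\le\|f\|_{L^2(\mathbb{T};\phi)} .$$
   Context: $\mathbb{T}=\mathbb{R}/2\pi\mathbb{Z}$ with normalized Haar measure $m$. For $r\in(0,1)$, $P_r(e^{i\theta})=\frac{1}{2\pi}\sum_{n\in\mathbb{Z}}r^{|n|}e^{in\theta}=\frac1{2\pi}\frac{1-r^2}{|1-re^{i\theta}|^2}$; for a measure $\mu$, $(P_r*\mu)(e^{i\theta})=\int_{\mathbb{T}}P_r(e^{i(\theta-\theta')})d\mu(\theta')$; for an integrable function $g$, $(P_r*g)(e^{i\theta})=\int_0^{2\pi}P_r(e^{i(\theta-t)})g(e^{it})\,dt=\sum_{n\in\mathbb{Z}}r^{|n|}\widehat g(n)e^{in\theta}$, where $\widehat g(n)=\int_{\mathbb{T}}g(e^{it})e^{-int}dm(t)$. $H^2(\mathbb{T})$ is the set of $f(e^{i\theta})=\sum_{n\ge0}a_ne^{in\theta}$ with $\sum|a_n|^2<\infty$; $H^2_0(\mathbb{T})=\{f\in H^2(\mathbb{T}):\widehat f(0)=0\}$; $H^2_-(\mathbb{T})=L^2(\mathbb{T})\ominus H_0^2(\mathbb{T})$. $R_-:L^2(\mathbb{T})\to H_-^2(\mathbb{T})$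 is the orthogonal projection (keeping the Fourier modes $n\le0$). The Hankel operator is $H_\phi(f)=R_-(\phi f)$. $\|f\|_{L^2(\mathbb{T};\phi)}=\big(\int_{\mathbb{T}}|f(e^{it})|^2\phi(e^{it})dm(t)\big)^{1/2}$. *)

theory Defs
  imports "HOL-Probability.Probability"
begin

text \<open>The torus is realised as the unit circle in the complex plane, so that a function
  \<open>g(e\<^sup>i\<^sup>t)\<close> on the torus is a function \<open>g\<close> of a complex variable of which only the values on
  the circle matter. Elements of \<open>L\<^sup>2\<close> are represented by functions, not by classes modulo
  equality almost everywhere.\<close>

abbreviation circle_borel :: "complex measure" where
  "circle_borel \<equiv> restrict_space borel (sphere 0 1)"

definition haar :: "complex measure" where
  "haar = distr (uniform_measure lborel {0..2 * pi}) circle_borel cis"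

lemma cis_measurable_circle: "cis \<in> borel \<rightarrow>\<^sub>M circle_borel"
  by (rule measurable_restrict_space2)
    (auto intro!: borel_measurable_continuous_onI continuous_intros)

lemma prob_space_haar: "prob_space haar"
  unfolding haar_def
proof (rule prob_space.prob_space_distr)
  show "prob_space (uniform_measure lborel {0..2 * pi})"
    by (rule prob_space_uniform_measure) auto
qed (use cis_measurable_circle in simp)

definition poisson_kernel :: "real \<Rightarrow> complex \<Rightarrow> real" where
  "poisson_kernel r z = 1 / (2 * pi) * ((1 - r\<^sup>2) / (cmod (1 - of_real r * z))\<^sup>2)"

text \<open>On the circle \<open>e\<^sup>i\<^sup>(\<^sup>\<theta>\<^sup>-\<^sup>t\<^sup>) = z * cnj w\<close> for \<open>z = e\<^sup>i\<^sup>\<theta>\<close>, \<open>w = e\<^sup>i\<^sup>t\<close>.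
  The convolution with a function is against the unnormalised measure \<open>dt\<close> on \<open>[0, 2\<pi>]\<close>;
  the normalisation is in the factor \<open>1 / (2\<pi>)\<close> of the kernel.\<close>

definition poisson_measure :: "real \<Rightarrow> complex measure \<Rightarrow> complex \<Rightarrow> real" where
  "poisson_measure r \<mu> z = (LINT w|\<mu>. poisson_kernel r (z * cnj w))"

definition poisson_fun ::
    "real \<Rightarrow> (complex \<Rightarrow> 'a::{banach, second_countable_topology}) \<Rightarrow> complex \<Rightarrow> 'a" where
  "poisson_fun r g z = (LINT t:{0..2 * pi}|lborel. poisson_kernel r (z * cnj (cis t)) *\<^sub>R g (cis t))"

definition fourier :: "(complex \<Rightarrow> complex) \<Rightarrow> int \<Rightarrow> complex" where
  "fourier g n = (LINT z|haar. g z * z powi (- n))"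

definition L2 :: "(complex \<Rightarrow> complex) set" where
  "L2 = {g. g \<in> borel_measurable haar \<and> integrable haar (\<lambda>z. (cmod (g z))\<^sup>2)}"

definition L2_inner :: "(complex \<Rightarrow> complex) \<Rightarrow> (complex \<Rightarrow> complex) \<Rightarrow> complex" where
  "L2_inner f g = (LINT z|haar. f z * cnj (g z))"

text \<open>The series \<open>\<Sum>n\<ge>0. a\<^sub>n z\<^sup>n\<close> converges in the \<open>L\<^sup>2\<close> norm.\<close>

definition H2 :: "(complex \<Rightarrow> complex) set" where
  "H2 = {f \<in> L2. \<exists>a :: nat \<Rightarrow> complex. summable (\<lambda>n. (cmod (a n))\<^sup>2) \<and>
     (\<lambda>N. LINT z|haar. (cmod (f z - (\<Sum>n<N. a n * z ^ n)))\<^sup>2) \<longlonglongrightarrow> 0}"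

definition H2_0 :: "(complex \<Rightarrow> complex) set" where
  "H2_0 = {f \<in> H2. fourier f 0 = 0}"

definition H2_minus :: "(complex \<Rightarrow> complex) set" where
  "H2_minus = {g \<in> L2. \<forall>f \<in> H2_0. L2_inner g f = 0}"

text \<open>Orthogonal projection of \<open>L\<^sup>2\<close> onto \<open>H2_minus\<close>. As an element of \<open>L\<^sup>2\<close> it is unique
  only up to equality almost everywhere; an arbitrary representative is chosen.\<close>

definition R_minus :: "(complex \<Rightarrow> complex) \<Rightarrow> complex \<Rightarrow> complex" where
  "R_minus g = (SOME h. h \<in> H2_minus \<and> (\<forall>k \<in> H2_minus. L2_inner (\<lambda>z. g z - h z) k = 0))"

definition hankel :: "(complex \<Rightarrow> complex) \<Rightarrow> (complex \<Rightarrow> complex) \<Rightarrow> complex \<Rightarrow> complex" where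
  "hankel \<phi> f = R_minus (\<lambda>z. \<phi> z * f z)"

definition weighted_L2_norm :: "(complex \<Rightarrow> real) \<Rightarrow> (complex \<Rightarrow> complex) \<Rightarrow> real" where
  "weighted_L2_norm \<phi> f = sqrt (LINT z|haar. (cmod (f z))\<^sup>2 * \<phi> z)"

definition Linf_norm :: "(complex \<Rightarrow> complex) \<Rightarrow> ereal" where
  "Linf_norm g = esssup haar (\<lambda>z. ereal (cmod (g z)))"

end

theory Submission
  imports Defs
begin

text \<open>
  For \<open>a\<close> in the disc let \<open>P\<^sub>a(u) = (1 - |a|\<^sup>2) / |1 - cnj a u|\<^sup>2\<close>, so that integration of an analytic
  function against \<open>P\<^sub>a\<close> gives its value at \<open>a\<close>. The assumption on the weight says that, with \<open>\<rho>\<^sup>2 = 2/3\<close>,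
  \<open>\<phi>\<close> is \<open>1 / (2 \<pi>)\<close> times the integral of \<open>P\<^sub>a\<close> over \<open>d\<mu>(w)\<close>, where \<open>a = \<rho> w\<close>.
  For one base point \<open>a\<close> everything can be computed. Splitting \<open>P\<^sub>a\<close> into its analytic and
  antianalytic halves, the projection of \<open>P\<^sub>a f\<close> to the modes \<open>n \<le> 0\<close> is \<open>f(a) / (1 - a cnj u)\<close>, and
  smoothing with the Poisson kernel of radius \<open>s\<close> gives \<open>f(a) q\<close> at \<open>z\<close>, where \<open>q = 1 / (1 - s cnj z a)\<close>;
  smoothing \<open>P\<^sub>a\<close> itself gives \<open>(1 - s\<^sup>2 \<rho>\<^sup>2) |q|\<^sup>2\<close>. Finally \<open>|f(a)|\<^sup>2 \<le> \<rho>\<^sup>2 \<integral> |f|\<^sup>2 P\<^sub>a\<close>, because \<open>f\<close> vanishes at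
  the origin. Integrating over \<open>\<mu>\<close> and using the Cauchy-Schwarz inequality in \<open>L\<^sup>2(\<mu>)\<close>, the square of the
  quotient in the theorem is at most \<open>\<rho>\<^sup>2 / (1 - s\<^sup>2 \<rho>\<^sup>2)\<close> times the squared weighted norm of \<open>f\<close>
  (\<open>poisson_hankel_bound\<close>, for all radii). The radii \<open>\<rho>\<^sup>2 = 2/3\<close> and \<open>s\<^sup>2 = 1/2\<close> make this factor \<open>1\<close>.

  All evaluations rest on one fact, \<open>harmonic_density_multiplicative\<close>: integration against \<open>P\<^sub>a\<close> is
  multiplicative on analytic functions. It yields the values above, the Schwarz lemma
  \<open>harmonic_extension_at_bound\<close>, and also the existence of the orthogonal projection of \<open>\<phi> f\<close>
  (\<open>hankel_characterisation\<close>), which is exhibited as an integral over \<open>\<mu>\<close> instead of being drawn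
  from the completeness of \<open>L\<^sup>2\<close>.
\<close>

section \<open>Integration over general measure spaces\<close>

lemma square_integrable_mult:
  fixes f g :: "'a \<Rightarrow> complex"
  assumes [measurable]: "f \<in> borel_measurable M" "g \<in> borel_measurable M"
    and f: "integrable M (\<lambda>x. (cmod (f x))\<^sup>2)" and g: "integrable M (\<lambda>x. (cmod (g x))\<^sup>2)"
  shows "integrable M (\<lambda>x. f x * g x)"
proof (rule Bochner_Integration.integrable_bound)
  show "integrable M (\<lambda>x. (cmod (f x))\<^sup>2 + (cmod (g x))\<^sup>2)"
    using f g by simp
  show "AE x in M. norm (f x * g x) \<le> norm ((cmod (f x))\<^sup>2 + (cmod (g x))\<^sup>2)"
  proof (rule AE_I2)
    fix x
    have "2 * (cmod (f x) * cmod (g x)) \<le> (cmod (f x))\<^sup>2 + (cmod (g x))\<^sup>2"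
      using sum_squares_bound[of "cmod (f x)" "cmod (g x)"] by simp
    moreover have "0 \<le> cmod (f x) * cmod (g x)" by simp
    ultimately show "norm (f x * g x) \<le> norm ((cmod (f x))\<^sup>2 + (cmod (g x))\<^sup>2)"
      unfolding norm_mult real_norm_def by linarith
  qed
qed measurable

text \<open>The discriminant argument: \<open>\<integral> (t |f| - |g|)\<^sup>2\<close> is a quadratic in \<open>t\<close> that is never negative.\<close>

lemma Cauchy_Schwarz_integral:
  fixes f g :: "'a \<Rightarrow> complex"
  assumes m[measurable]: "f \<in> borel_measurable M" "g \<in> borel_measurable M"
    and f: "integrable M (\<lambda>x. (cmod (f x))\<^sup>2)" and g: "integrable M (\<lambda>x. (cmod (g x))\<^sup>2)"
  shows "(cmod (LINT x|M. f x * g x))\<^sup>2 \<le>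
    (LINT x|M. (cmod (f x))\<^sup>2) * (LINT x|M. (cmod (g x))\<^sup>2)"
proof -
  define A where "A = (LINT x|M. (cmod (f x))\<^sup>2)"
  define B where "B = (LINT x|M. (cmod (g x))\<^sup>2)"
  define C where "C = (LINT x|M. cmod (f x) * cmod (g x))"
  have int: "integrable M (\<lambda>x. cmod (f x) * cmod (g x))"
    using integrable_norm[OF square_integrable_mult[OF m f g]] by (simp add: norm_mult)
  have C: "cmod (LINT x|M. f x * g x) \<le> C"
    unfolding C_def using integral_norm_bound[of M "\<lambda>x. f x * g x"] by (simp add: norm_mult)
  have C0: "0 \<le> C" unfolding C_def by (intro integral_nonneg_AE) simp
  have quad: "0 \<le> t\<^sup>2 * A - 2 * t * C + B" for t
  proof -
    have "0 \<le> (LINT x|M. (t * cmod (f x) - cmod (g x))\<^sup>2)"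
      by (intro integral_nonneg_AE) simp
    also have "\<dots> = (LINT x|M. t\<^sup>2 * (cmod (f x))\<^sup>2 - 2 * t * (cmod (f x) * cmod (g x)) + (cmod (g x))\<^sup>2)"
      by (rule Bochner_Integration.integral_cong) (auto simp: power2_eq_square algebra_simps)
    also have "\<dots> = t\<^sup>2 * A - 2 * t * C + B"
      unfolding A_def B_def C_def using f g int by simp
    finally show ?thesis .
  qed
  have "C\<^sup>2 \<le> A * B"
  \<comment> \<open>If \<open>A = 0\<close>, the quadratic is affine and so \<open>C = 0\<close>; otherwise it is smallest at \<open>t = C / A\<close>.\<close>
  proof (cases "A = 0")
    case True
    have "C = 0"
    proof (rule ccontr)
      assume "C \<noteq> 0"
      then show False using quad[of "(B + 1) / (2 * C)"] True by simp
    qed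
    then show ?thesis using True by simp
  next
    case False
    then have "A > 0" unfolding A_def
      by (metis (mono_tags, lifting) integral_nonneg_AE AE_I2 zero_le_power2 less_eq_real_def)
    moreover from False have "(C / A)\<^sup>2 * A - 2 * (C / A) * C + B = B - C\<^sup>2 / A"
      by (simp add: field_simps power2_eq_square)
    ultimately have "C\<^sup>2 / A \<le> B" using quad[of "C / A"] by linarith
    then show ?thesis using \<open>A > 0\<close> by (simp add: field_simps)
  qed
  moreover have "(cmod (LINT x|M. f x * g x))\<^sup>2 \<le> C\<^sup>2" using C by (intro power_mono) auto
  ultimately show ?thesis unfolding A_def B_def by linarith
qed

text \<open>Every exchange of integrals below is between a finite measure and the circle, for a kernel whose first
  variable only contributes a bounded factor; domination by a function of the second variable alone
  then supplies all the integrability that Fubini asks for.\<close>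

lemma Fubini_dominated:
  fixes k :: "'a \<Rightarrow> 'b \<Rightarrow> 'c :: {banach, second_countable_topology}"
  assumes "finite_measure M" "finite_measure N"
    and [measurable]: "(\<lambda>(x, y). k x y) \<in> borel_measurable (M \<Otimes>\<^sub>M N)"
    and g: "integrable N g"
    and bound: "\<And>x y. x \<in> space M \<Longrightarrow> y \<in> space N \<Longrightarrow> norm (k x y) \<le> g y"
  shows "(LINT y|N. LINT x|M. k x y) = (LINT x|M. LINT y|N. k x y)"
    and "integrable M (\<lambda>x. LINT y|N. k x y)"
    and "integrable N (\<lambda>y. LINT x|M. k x y)"
    and "x \<in> space M \<Longrightarrow> integrable N (k x)"
proof -
  interpret M: finite_measure M by fact
  interpret N: finite_measure N by fact
  interpret pair_sigma_finite M N ..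
  have int: "integrable N (k x)" if "x \<in> space M" for x
  proof (rule Bochner_Integration.integrable_bound[OF g])
    show "k x \<in> borel_measurable N" using that by measurable
    show "AE y in N. norm (k x y) \<le> norm (g y)"
      using bound[OF that] by (intro AE_I2) (metis abs_ge_self order_trans real_norm_def)
  qed
  have pair: "integrable (M \<Otimes>\<^sub>M N) (\<lambda>(x, y). k x y)"
  proof (rule Fubini_integrable)
    show "integrable M (\<lambda>x. LINT y|N. norm (case (x, y) of (x, y) \<Rightarrow> k x y))"
    proof (rule M.integrable_const_bound)
      show "AE x in M. norm (LINT y|N. norm (case (x, y) of (x, y) \<Rightarrow> k x y)) \<le> (LINT y|N. g y)"
      proof (rule AE_I2)
        fix x assume x: "x \<in> space M"
        have "(LINT y|N. norm (k x y)) \<le> (LINT y|N. g y)"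
          using int[OF x] g bound[OF x] by (intro integral_mono) auto
        then show "norm (LINT y|N. norm (case (x, y) of (x, y) \<Rightarrow> k x y)) \<le> (LINT y|N. g y)"
          by (simp add: integral_nonneg_AE)
      qed
    qed measurable
  qed (use int in auto)
  show "(LINT y|N. LINT x|M. k x y) = (LINT x|M. LINT y|N. k x y)"
    using Fubini_integral[OF pair] .
  show "integrable M (\<lambda>x. LINT y|N. k x y)" using integrable_fst[OF pair] .
  show "integrable N (\<lambda>y. LINT x|M. k x y)" using integrable_snd[OF pair] .
  show "x \<in> space M \<Longrightarrow> integrable N (k x)" by (rule int)
qed

section \<open>Haar measure and square integrable functions on the circle\<close>

interpretation haar: prob_space haar by (rule prob_space_haar)

lemma space_haar [simp]: "space haar = sphere 0 1"
  by (simp add: haar_def space_restrict_space)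

lemma sets_haar [measurable_cong]: "sets haar = sets circle_borel"
  by (simp add: haar_def)

lemma borel_measurable_circle:
  assumes "sets M = sets circle_borel" "f \<in> borel_measurable borel"
  shows "f \<in> borel_measurable M"
  using assms measurable_restrict_space1 by (metis measurable_cong_sets)

lemma integral_haar:
  fixes g :: "complex \<Rightarrow> 'a :: {banach, second_countable_topology}"
  assumes "g \<in> borel_measurable haar"
  shows "(LINT t:{0..2 * pi}|lborel. g (cis t)) = (2 * pi) *\<^sub>R (LINT z|haar. g z)"
proof -
  have g: "g \<in> borel_measurable circle_borel"
    using assms measurable_cong_sets[OF sets_haar refl] by blast
  have [measurable]: "(\<lambda>t. g (cis t)) \<in> borel_measurable borel"
    using measurable_compose[OF cis_measurable_circle g] .
  have "(LINT z|haar. g z) = (LINT t|uniform_measure lborel {0..2 * pi}. g (cis t))"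
    unfolding haar_def using cis_measurable_circle g
    by (intro integral_distr) auto
  also have "uniform_measure lborel {0..2 * pi} =
      density lborel (\<lambda>t. ennreal (indicator {0..2 * pi} t / (2 * pi)))"
    unfolding uniform_measure_def
    by (rule density_cong)
      (auto simp: divide_ennreal[symmetric] indicator_def ennreal_1[symmetric] simp del: ennreal_1 split: if_splits)
  also have "(LINT t|\<dots>. g (cis t)) = (LINT t|lborel. (indicator {0..2 * pi} t / (2 * pi)) *\<^sub>R g (cis t))"
    by (rule integral_density) auto
  also have "\<dots> = (LINT t|lborel. (1 / (2 * pi)) *\<^sub>R (indicator {0..2 * pi} t *\<^sub>R g (cis t)))"
    by (simp add: field_simps)
  also have "\<dots> = (1 / (2 * pi)) *\<^sub>R (LINT t:{0..2 * pi}|lborel. g (cis t))"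
    unfolding set_lebesgue_integral_def by (rule integral_scaleR_right)
  finally show ?thesis by simp
qed

lemma has_vector_derivative_cis_antiderivative:
  assumes "n > 0"
  shows "((\<lambda>t. cis (real n * t) / (\<i> * of_nat n)) has_vector_derivative cis (real n * x))
    (at x within A)"
proof -
  have "(\<lambda>t. (t * real n) *\<^sub>R (\<i> * cis (real n * x))) =
      (\<lambda>t. t *\<^sub>R real n *\<^sub>R (\<i> * cis (real n * x)))"
    by (simp only: scaleR_scaleR)
  with has_derivative_cis[OF has_derivative_mult_right[OF has_derivative_ident], of "real n" x A]
  have "((\<lambda>t. cis (real n * t)) has_vector_derivative real n *\<^sub>R (\<i> * cis (real n * x)))
      (at x within A)"
    unfolding has_vector_derivative_def by (simp only: mult.commute[of "real n"])
  then have "((\<lambda>t. cis (real n * t) / (\<i> * of_nat n)) has_vector_derivative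
      (real n *\<^sub>R (\<i> * cis (real n * x))) / (\<i> * of_nat n)) (at x within A)"
    by (rule has_vector_derivative_divide)
  moreover have "(real n *\<^sub>R (\<i> * cis (real n * x))) / (\<i> * of_nat n) = cis (real n * x)"
    unfolding scaleR_conv_of_real using assms by simp
  ultimately show ?thesis by (simp only:)
qed

lemma integral_haar_power:
  assumes "n > 0"
  shows "(LINT z|haar. z ^ n) = 0"
proof -
  have "(LINT t:{0..2 * pi}|lborel. cis t ^ n) =
      cis (real n * (2 * pi)) / (\<i> * of_nat n) - cis (real n * 0) / (\<i> * of_nat n)"
    unfolding set_lebesgue_integral_def Complex.DeMoivre
    by (rule integral_FTC_atLeastAtMost)
      (use assms has_vector_derivative_cis_antiderivative in \<open>auto intro!: continuous_intros\<close>)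
  also have "cis (real n * (2 * pi)) = 1"
    using cis_multiple_2pi[of "real n"] by (simp only: mult.commute Ints_of_nat simp_thms)
  also have "1 / (\<i> * of_nat n) - cis (real n * 0) / (\<i> * of_nat n) = 0"
    by simp
  finally have "(LINT t:{0..2 * pi}|lborel. cis t ^ n) = 0" .
  moreover have "(LINT t:{0..2 * pi}|lborel. cis t ^ n) = (2 * pi) *\<^sub>R (LINT z|haar. z ^ n)"
    by (rule integral_haar) (auto intro: borel_measurable_circle[OF sets_haar])
  ultimately show ?thesis by simp
qed

lemma L2_measurable: "f \<in> L2 \<Longrightarrow> f \<in> borel_measurable haar"
  by (simp add: L2_def)

lemma bounded_L2:
  assumes m: "b \<in> borel_measurable haar" and bound: "\<And>u. cmod u = 1 \<Longrightarrow> cmod (b u) \<le> B"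
  shows "b \<in> L2"
proof -
  have "integrable haar (\<lambda>u. (cmod (b u))\<^sup>2)"
    by (rule haar.integrable_const_bound[of _ "B\<^sup>2"])
      (use m bound in \<open>auto intro!: AE_I2 power_mono\<close>)
  then show ?thesis using m by (simp add: L2_def)
qed

lemma L2_mult_bounded:
  assumes f: "f \<in> L2" and m: "b \<in> borel_measurable haar"
    and bound: "\<And>u. cmod u = 1 \<Longrightarrow> cmod (b u) \<le> B"
  shows "(\<lambda>u. f u * b u) \<in> L2"
proof -
  note [measurable] = L2_measurable[OF f] m
  have "integrable haar (\<lambda>u. B\<^sup>2 * (cmod (f u))\<^sup>2)"
    using f by (simp add: L2_def)
  then have "integrable haar (\<lambda>u. (cmod (f u * b u))\<^sup>2)"
  proof (rule Bochner_Integration.integrable_bound)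
    show "AE u in haar. norm ((cmod (f u * b u))\<^sup>2) \<le> norm (B\<^sup>2 * (cmod (f u))\<^sup>2)"
      using bound
      by (intro AE_I2) (auto simp: norm_mult power_mult_distrib mult.commute intro!: mult_right_mono power_mono)
  qed measurable
  then show ?thesis by (simp add: L2_def)
qed

lemma L2_mult_integrable:
  assumes "f \<in> L2" "g \<in> L2"
  shows "integrable haar (\<lambda>u. f u * g u)"
  using assms by (intro square_integrable_mult) (auto simp: L2_def)

lemma L2_integrable: "f \<in> L2 \<Longrightarrow> integrable haar f"
  using L2_mult_integrable[of f "\<lambda>_. 1"] bounded_L2[of "\<lambda>_. 1" 1] by simp

lemma L2_diff:
  assumes f: "f \<in> L2" and g: "g \<in> L2"
  shows "(\<lambda>u. f u - g u) \<in> L2"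
proof -
  note [measurable] = L2_measurable[OF f] L2_measurable[OF g]
  have "integrable haar (\<lambda>u. 2 * (cmod (f u))\<^sup>2 + 2 * (cmod (g u))\<^sup>2)"
    using f g by (simp add: L2_def)
  then have "integrable haar (\<lambda>u. (cmod (f u - g u))\<^sup>2)"
  proof (rule Bochner_Integration.integrable_bound)
    show "AE u in haar. norm ((cmod (f u - g u))\<^sup>2) \<le> norm (2 * (cmod (f u))\<^sup>2 + 2 * (cmod (g u))\<^sup>2)"
    proof (rule AE_I2)
      fix u
      have "(cmod (f u - g u))\<^sup>2 \<le> (cmod (f u) + cmod (g u))\<^sup>2"
        by (intro power_mono norm_triangle_ineq4) auto
      also have "\<dots> \<le> 2 * (cmod (f u))\<^sup>2 + 2 * (cmod (g u))\<^sup>2"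
        using sum_squares_bound[of "cmod (f u)" "cmod (g u)"] by (simp add: power2_sum)
      finally show "norm ((cmod (f u - g u))\<^sup>2) \<le> norm (2 * (cmod (f u))\<^sup>2 + 2 * (cmod (g u))\<^sup>2)"
        by simp
    qed
  qed measurable
  then show ?thesis by (simp add: L2_def)
qed

text \<open>Pairing with a fixed square integrable function is continuous in \<open>L\<^sup>2\<close>; this carries identities
  from polynomials to all of the Hardy space.\<close>

lemma L2_convergence_integral:
  assumes f: "f \<in> L2" and p: "\<And>N. p N \<in> L2" and g: "g \<in> L2"
    and lim: "(\<lambda>N. LINT u|haar. (cmod (f u - p N u))\<^sup>2) \<longlonglongrightarrow> 0"
  shows "(\<lambda>N. LINT u|haar. p N u * g u) \<longlonglongrightarrow> (LINT u|haar. f u * g u)"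
proof -
  define G where "G = (LINT u|haar. (cmod (g u))\<^sup>2)"
  define D where "D N = (LINT u|haar. (cmod (f u - p N u))\<^sup>2)" for N
  have "(\<lambda>N. sqrt (D N * G)) \<longlonglongrightarrow> sqrt (0 * G)"
    unfolding D_def by (intro tendsto_intros lim)
  then have lim0: "(\<lambda>N. sqrt (D N * G)) \<longlonglongrightarrow> 0" by simp
  have "cmod ((LINT u|haar. p N u * g u) - (LINT u|haar. f u * g u))
      \<le> sqrt (D N * G)" for N
  proof -
    have "(LINT u|haar. f u * g u) - (LINT u|haar. p N u * g u) = (LINT u|haar. (f u - p N u) * g u)"
      using L2_mult_integrable[OF f g] L2_mult_integrable[OF p g] by (simp add: algebra_simps)
    moreover have "(cmod (LINT u|haar. (f u - p N u) * g u))\<^sup>2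
        \<le> D N * G"
      unfolding D_def G_def using L2_diff[OF f p, of N] g by (intro Cauchy_Schwarz_integral) (auto simp: L2_def)
    ultimately show ?thesis
      by (subst norm_minus_commute) (simp add: real_le_rsqrt)
  qed
  then have "\<forall>\<^sub>F N in sequentially. norm ((LINT u|haar. p N u * g u) - (LINT u|haar. f u * g u))
      \<le> sqrt (D N * G)"
    by (intro always_eventually allI)
  then show ?thesis
    using lim0 by (rule LIM_zero_cancel[OF Lim_null_comparison])
qed

lemma power_L2: "(\<lambda>u. u ^ n) \<in> L2"
  by (rule bounded_L2[where B = 1]) (auto intro: borel_measurable_circle[OF sets_haar] simp: norm_power)

lemma L2_mult_power: "f \<in> L2 \<Longrightarrow> (\<lambda>u. f u * u ^ n) \<in> L2"
  by (rule L2_mult_bounded[where B = 1])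
    (auto intro: borel_measurable_circle[OF sets_haar] simp: norm_power)

lemma poly_L2: "(\<lambda>u. \<Sum>n<N. a n * u ^ n) \<in> L2"
proof (rule bounded_L2[where B = "\<Sum>n<N. cmod (a n)"])
  show "(\<lambda>u. \<Sum>n<N. a n * u ^ n) \<in> borel_measurable haar"
    by (auto intro: borel_measurable_circle[OF sets_haar])
next
  fix u :: complex assume "cmod u = 1"
  then show "cmod (\<Sum>n<N. a n * u ^ n) \<le> (\<Sum>n<N. cmod (a n))"
    by (intro sum_norm_le) (simp add: norm_mult norm_power)
qed

section \<open>Szego kernels and harmonic measures\<close>

text \<open>\<open>H\<^sup>2\<^sub>0\<close> described by orthogonality, as the functions with no Fourier mode \<open>n \<le> 0\<close>. That these conditions
  imply \<open>L\<^sup>2\<close> convergence of the Fourier series is the completeness of the trigonometric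
  system; working with the moments instead avoids it.\<close>

definition vanishing_moments :: "(complex \<Rightarrow> complex) \<Rightarrow> bool" where
  "vanishing_moments f \<longleftrightarrow> f \<in> L2 \<and> (\<forall>n. (LINT u|haar. f u * u ^ n) = 0)"

definition szego_kernel :: "complex \<Rightarrow> complex \<Rightarrow> complex" where
  "szego_kernel b u = 1 / (1 - b * u)"

text \<open>The density, with respect to normalised Haar measure, of harmonic measure for the point \<open>a\<close> of
  the disc: integrating against it evaluates the harmonic extension at \<open>a\<close>.\<close>

definition harmonic_density :: "complex \<Rightarrow> complex \<Rightarrow> real" where
  "harmonic_density a u = (1 - (cmod a)\<^sup>2) / (cmod (1 - cnj a * u))\<^sup>2"

lemma szego_kernel_measurable: "szego_kernel b \<in> borel_measurable haar"
  unfolding szego_kernel_def[abs_def] by (rule borel_measurable_circle[OF sets_haar]) measurable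

lemma harmonic_density_measurable: "harmonic_density a \<in> borel_measurable haar"
  unfolding harmonic_density_def[abs_def] by (rule borel_measurable_circle[OF sets_haar]) measurable

lemma one_minus_mult_bound:
  fixes b u :: complex
  assumes "cmod b < 1" "cmod u = 1"
  shows "1 - cmod b \<le> cmod (1 - b * u)" "1 - b * u \<noteq> 0"
proof -
  show *: "1 - cmod b \<le> cmod (1 - b * u)"
    using norm_triangle_ineq2[of 1 "b * u"] assms by (simp add: norm_mult)
  show "1 - b * u \<noteq> 0" using * assms by auto
qed

lemma szego_kernel_bound:
  assumes "cmod b < 1" "cmod u = 1"
  shows "cmod (szego_kernel b u) \<le> 1 / (1 - cmod b)"
  using one_minus_mult_bound[OF assms] assms
  by (simp add: szego_kernel_def norm_divide frac_le)

lemma szego_kernel_rec: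
  assumes "cmod b < 1" "cmod u = 1"
  shows "szego_kernel b u = 1 + b * u * szego_kernel b u"
  using one_minus_mult_bound[OF assms] by (simp add: szego_kernel_def field_simps)

lemma harmonic_density_nonneg: "cmod a < 1 \<Longrightarrow> 0 \<le> harmonic_density a u"
  by (simp add: harmonic_density_def abs_square_le_1)

lemma harmonic_density_bound:
  assumes "cmod a < 1" "cmod u = 1"
  shows "harmonic_density a u \<le> 1 / (1 - cmod a)\<^sup>2"
  unfolding harmonic_density_def using one_minus_mult_bound[of "cnj a" u] assms
  by (intro frac_le) (auto intro!: power_mono)

text \<open>Multiplying by \<open>1 / (1 - b u) = \<Sum> b\<^sup>k u\<^sup>k\<close> only raises Fourier modes. In place of exchanging the
  series with the integral, the geometric recursion \<open>q = 1 + b u q\<close> is iterated \<open>K\<close> times: it leaves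
  \<open>b\<^sup>K\<close> times a bounded moment, which tends to \<open>0\<close>.\<close>

lemma vanishing_moments_mult_szego_kernel:
  assumes f: "vanishing_moments f" and b: "cmod b < 1"
  shows "vanishing_moments (\<lambda>u. f u * szego_kernel b u)"
proof -
  let ?q = "szego_kernel b"
  have fL: "f \<in> L2" and f0: "\<And>n. (LINT u|haar. f u * u ^ n) = 0"
    using f by (auto simp: vanishing_moments_def)
  have L: "(\<lambda>u. f u * ?q u) \<in> L2"
    by (rule L2_mult_bounded[OF fL szego_kernel_measurable szego_kernel_bound[OF b]])
  define I where "I n = (LINT u|haar. f u * ?q u * u ^ n)" for n
  have step: "I n = b * I (Suc n)" for n
  proof -
    have "I n = (LINT u|haar. f u * u ^ n + b * (f u * ?q u * u ^ Suc n))"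
      unfolding I_def
    proof (rule Bochner_Integration.integral_cong)
      fix u assume "u \<in> space haar"
      then have "?q u = 1 + b * u * ?q u" by (intro szego_kernel_rec[OF b]) simp
      then have "f u * ?q u * u ^ n = f u * (1 + b * u * ?q u) * u ^ n" by (rule arg_cong)
      then show "f u * ?q u * u ^ n = f u * u ^ n + b * (f u * ?q u * u ^ Suc n)"
        by (simp add: algebra_simps)
    qed simp
    also have "\<dots> = (LINT u|haar. f u * u ^ n) + b * I (Suc n)"
      unfolding I_def
      using L2_integrable[OF L2_mult_power[OF fL, of n]] L2_integrable[OF L2_mult_power[OF L, of "Suc n"]]
      by (subst Bochner_Integration.integral_add) auto
    finally show ?thesis using f0 by simp
  qed
  have iter: "I n = b ^ K * I (n + K)" for n K
  proof (induction K)
    case (Suc K)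
    then show ?case using step[of "n + K"] by (simp add: mult.assoc)
  qed simp
  define C where "C = (LINT u|haar. cmod (f u * ?q u))"
  have bound: "cmod (I n) \<le> C" for n
  proof -
    have "cmod (I n) \<le> (LINT u|haar. cmod (f u * ?q u * u ^ n))"
      unfolding I_def by (rule integral_norm_bound)
    also have "\<dots> = C"
      unfolding C_def by (rule Bochner_Integration.integral_cong) (auto simp: norm_mult norm_power)
    finally show ?thesis .
  qed
  have "I n = 0" for n
  proof -
    have "(\<lambda>K. cmod b ^ K * C) \<longlonglongrightarrow> 0 * C"
      using b by (intro tendsto_intros LIMSEQ_realpow_zero) auto
    moreover have "cmod (I n) \<le> cmod b ^ K * C" for K
      using iter[of n K] bound[of "n + K"] by (metis mult_left_mono norm_ge_zero norm_mult norm_power)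
    ultimately have "cmod (I n) \<le> 0 * C"
      by (intro LIMSEQ_le_const) auto
    then show ?thesis by simp
  qed
  then show ?thesis using L by (simp add: vanishing_moments_def I_def)
qed

lemma vanishing_moments_mult_power:
  assumes "vanishing_moments f"
  shows "vanishing_moments (\<lambda>u. f u * u ^ n)"
  using assms L2_mult_power by (auto simp: vanishing_moments_def mult.assoc power_add[symmetric])

lemma vanishing_moments_ident: "vanishing_moments (\<lambda>u. u)"
  using power_L2[of 1] integral_haar_power[of "Suc n" for n] by (auto simp: vanishing_moments_def)

lemma integral_szego_kernel:
  assumes b: "cmod b < 1"
  shows "(LINT u|haar. szego_kernel b u) = 1"
proof -
  have vm: "vanishing_moments (\<lambda>u. u * szego_kernel b u)"
    by (rule vanishing_moments_mult_szego_kernel[OF vanishing_moments_ident b])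
  then have int: "integrable haar (\<lambda>u. u * szego_kernel b u)"
    and zero: "(LINT u|haar. u * szego_kernel b u) = 0"
    unfolding vanishing_moments_def using L2_integrable by (auto dest: spec[of _ 0])
  have "(LINT u|haar. szego_kernel b u) = (LINT u|haar. 1 + b * (u * szego_kernel b u))"
    unfolding mult.assoc[symmetric]
    by (rule Bochner_Integration.integral_cong[OF refl]) (rule szego_kernel_rec[OF b], simp)
  also have "\<dots> = 1" using int zero haar.prob_space by simp
  finally show ?thesis .
qed

text \<open>The Poisson kernel as \<open>\<Sum> x\<^sup>n + \<Sum> cnj x\<^sup>n - 1\<close>, its analytic part plus its
  antianalytic part with the constant term counted once.\<close>

lemma harmonic_sum_eq:
  assumes "cmod x < 1"
  shows "1 / (1 - x) + cnj (1 / (1 - x)) - 1 =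
    complex_of_real ((1 - (cmod x)\<^sup>2) / (cmod (1 - x))\<^sup>2)"
proof -
  let ?d = "1 - x"
  have nz: "?d \<noteq> 0" using assms by auto
  then have nz': "cnj ?d \<noteq> 0" by (metis complex_cnj_zero_iff)
  have num: "?d + cnj ?d - ?d * cnj ?d = 1 - x * cnj x"
    by (simp add: algebra_simps)
  have frac: "1 / p + 1 / q - 1 = (p + q - p * q) / (p * q)" if "p \<noteq> 0" "q \<noteq> 0" for p q :: complex
    using that by (simp add: field_simps)
  have "1 / ?d + cnj (1 / ?d) - 1 = 1 / ?d + 1 / cnj ?d - 1" by simp
  also have "\<dots> = (?d + cnj ?d - ?d * cnj ?d) / (?d * cnj ?d)" by (rule frac[OF nz nz'])
  also have "\<dots> = (1 - x * cnj x) / (?d * cnj ?d)" by (simp only: num)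
  also have "\<dots> = complex_of_real ((1 - (cmod x)\<^sup>2) / (cmod ?d)\<^sup>2)"
    unfolding of_real_divide of_real_diff of_real_1 complex_norm_square ..
  finally show ?thesis .
qed

lemma harmonic_density_eq:
  assumes "cmod a < 1" "cmod u = 1"
  shows "complex_of_real (harmonic_density a u) =
    szego_kernel (cnj a) u + cnj (szego_kernel (cnj a) u) - 1"
  using harmonic_sum_eq[of "cnj a * u"] assms
  by (simp add: szego_kernel_def harmonic_density_def norm_mult)

lemma L2_mult_harmonic_density:
  assumes "f \<in> L2" "cmod a < 1"
  shows "(\<lambda>u. f u * complex_of_real (harmonic_density a u)) \<in> L2"
  by (rule L2_mult_bounded[OF assms(1), where B = "1 / (1 - cmod a)\<^sup>2"])
    (use harmonic_density_measurable harmonic_density_bound harmonic_density_nonneg assms in auto)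

lemma integral_harmonic_density:
  assumes a: "cmod a < 1"
  shows "(LINT u|haar. complex_of_real (harmonic_density a u)) = 1"
proof -
  let ?q = "szego_kernel (cnj a)"
  have int: "integrable haar ?q"
    using a L2_integrable[OF bounded_L2[OF szego_kernel_measurable szego_kernel_bound[of "cnj a"]]]
    by simp
  have "(LINT u|haar. complex_of_real (harmonic_density a u)) = (LINT u|haar. ?q u + cnj (?q u) - 1)"
    by (rule Bochner_Integration.integral_cong) (use harmonic_density_eq[OF a] in auto)
  also have "\<dots> = 1 + cnj 1 - 1"
    using int integral_szego_kernel[of "cnj a"] a haar.prob_space by simp
  finally show ?thesis by simp
qed

section \<open>Hardy spaces and evaluation at points of the disc\<close>

lemma cnj_L2: "k \<in> L2 \<Longrightarrow> (\<lambda>u. cnj (k u)) \<in> L2"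
  using borel_measurable_continuous_onI[OF continuous_on_cnj[OF continuous_on_id]]
  by (auto simp: L2_def intro: measurable_compose)

lemma H2_0_vanishing_moments:
  assumes "f \<in> H2_0"
  shows "vanishing_moments f"
proof -
  from assms obtain a where f: "f \<in> L2" and f0: "fourier f 0 = 0"
    and lim: "(\<lambda>N. LINT z|haar. (cmod (f z - (\<Sum>n<N. a n * z ^ n)))\<^sup>2) \<longlonglongrightarrow> 0"
    unfolding H2_0_def H2_def by blast
  have "(LINT u|haar. f u * u ^ n) = 0" for n
  proof (cases "n = 0")
    case True
    then show ?thesis using f0 by (simp add: fourier_def)
  next
    case False
    have "(\<lambda>N. LINT u|haar. (\<Sum>k<N. a k * u ^ k) * u ^ n) \<longlonglongrightarrow> (LINT u|haar. f u * u ^ n)"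
      by (rule L2_convergence_integral[OF f poly_L2 power_L2 lim])
    moreover have "(LINT u|haar. (\<Sum>k<N. a k * u ^ k) * u ^ n) = 0" for N
    proof -
      have "(LINT u|haar. (\<Sum>k<N. a k * u ^ k) * u ^ n) = (LINT u|haar. (\<Sum>k<N. a k * u ^ (k + n)))"
        by (simp add: sum_distrib_right power_add mult.assoc)
      also have "\<dots> = (\<Sum>k<N. (LINT u|haar. a k * u ^ (k + n)))"
        by (intro Bochner_Integration.integral_sum integrable_mult_right L2_integrable power_L2)
      also have "\<dots> = 0" using False integral_haar_power by simp
      finally show ?thesis .
    qed
    ultimately show ?thesis using LIMSEQ_unique[OF _ tendsto_const] by simp
  qed
  then show ?thesis using f by (simp add: vanishing_moments_def)
qed

lemma power_H2_0:
  assumes "n > 0"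
  shows "(\<lambda>u. u ^ n) \<in> H2_0"
proof -
  define a where "a k = (if k = n then 1 else 0 :: complex)" for k
  have sum: "(\<Sum>k<N. a k * u ^ k) = u ^ n" if "N > n" for N and u :: complex
    using that by (simp add: a_def if_distrib[of "\<lambda>x. x * _"] sum.delta cong: if_cong)
  have "summable (\<lambda>k. (cmod (a k))\<^sup>2)"
    by (rule summable_finite[of "{n}"]) (auto simp: a_def)
  moreover have "(\<lambda>N. LINT z|haar. (cmod (z ^ n - (\<Sum>k<N. a k * z ^ k)))\<^sup>2) \<longlonglongrightarrow> 0"
  proof (rule tendsto_eventually)
    show "\<forall>\<^sub>F N in sequentially. (LINT z|haar. (cmod (z ^ n - (\<Sum>k<N. a k * z ^ k)))\<^sup>2) = 0"
      using eventually_gt_at_top[of n] by eventually_elim (simp add: sum)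
  qed
  moreover have "fourier (\<lambda>u. u ^ n) 0 = 0"
    using integral_haar_power[OF assms] by (simp add: fourier_def)
  ultimately show ?thesis using power_L2 unfolding H2_0_def H2_def by blast
qed

lemma H2_minus_vanishing_moments:
  assumes "k \<in> H2_minus"
  shows "vanishing_moments (\<lambda>u. u * cnj (k u))"
proof -
  have k: "k \<in> L2" and ortho: "\<And>f. f \<in> H2_0 \<Longrightarrow> L2_inner k f = 0"
    using assms by (auto simp: H2_minus_def)
  have "(LINT u|haar. u * cnj (k u) * u ^ n) = 0" for n
  proof -
    have "(LINT u|haar. u * cnj (k u) * u ^ n) = (LINT u|haar. cnj (k u * cnj (u ^ Suc n)))"
      by (simp add: mult_ac)
    also have "\<dots> = cnj (L2_inner k (\<lambda>u. u ^ Suc n))"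
      unfolding L2_inner_def by (rule Bochner_Integration.integral_cnj)
    also have "\<dots> = 0" using ortho[OF power_H2_0[of "Suc n"]] by simp
    finally show ?thesis .
  qed
  moreover have "(\<lambda>u. u * cnj (k u)) \<in> L2"
    using L2_mult_power[OF cnj_L2[OF k], of 1] by (simp add: mult.commute)
  ultimately show ?thesis by (simp add: vanishing_moments_def)
qed

text \<open>The denominator of the density is \<open>|1 - cnj a u|\<^sup>2 = |u - a|\<^sup>2\<close> on the circle, so the factor
  \<open>u - a\<close> leaves a single, analytic, Szego kernel.\<close>

lemma harmonic_density_mult:
  assumes "cmod a < 1" "cmod u = 1"
  shows "(u - a) * complex_of_real (harmonic_density a u) =
    complex_of_real (1 - (cmod a)\<^sup>2) * (u * szego_kernel (cnj a) u)"
proof -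
  let ?d = "1 - cnj a * u"
  have nz: "?d \<noteq> 0" using one_minus_mult_bound[of "cnj a" u] assms by simp
  then have nz': "cnj ?d \<noteq> 0" by (metis complex_cnj_zero_iff)
  have u: "u * cnj u = 1" using assms by (metis complex_norm_square of_real_1 one_power2)
  have d: "u - a = u * cnj ?d" using u by (simp add: algebra_simps)
  have "complex_of_real (harmonic_density a u) = complex_of_real (1 - (cmod a)\<^sup>2) / (?d * cnj ?d)"
    unfolding harmonic_density_def of_real_divide complex_norm_square[of ?d] ..
  then have "(u - a) * complex_of_real (harmonic_density a u)
      = u * cnj ?d * (complex_of_real (1 - (cmod a)\<^sup>2) / (?d * cnj ?d))"
    by (simp only: d)
  also have "\<dots> = complex_of_real (1 - (cmod a)\<^sup>2) * (u * (1 / ?d))"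
    using nz' by (simp only: divide_inverse inverse_mult_distrib) (simp only: mult_ac right_inverse, simp)
  finally show ?thesis by (simp only: szego_kernel_def)
qed

text \<open>By \<open>harmonic_density_mult\<close> the integrand \<open>(u - a) \<kappa> P\<^sub>a\<close> is a multiple of
  \<open>u \<kappa> / (1 - cnj a u)\<close>, whose zeroth moment vanishes.\<close>

lemma integral_ident_mult_harmonic_density:
  assumes \<kappa>: "\<kappa> \<in> L2" and vm: "vanishing_moments (\<lambda>u. u * \<kappa> u)" and a: "cmod a < 1"
  shows "(LINT u|haar. u * \<kappa> u * complex_of_real (harmonic_density a u)) =
    a * (LINT u|haar. \<kappa> u * complex_of_real (harmonic_density a u))"
proof -
  let ?P = "\<lambda>u. complex_of_real (harmonic_density a u)"
  have L: "(\<lambda>u. u * \<kappa> u) \<in> L2" using vm by (simp add: vanishing_moments_def)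
  have "(LINT u|haar. u * \<kappa> u * ?P u) - a * (LINT u|haar. \<kappa> u * ?P u) =
      (LINT u|haar. u * \<kappa> u * ?P u - a * (\<kappa> u * ?P u))"
    using L2_integrable[OF L2_mult_harmonic_density[OF \<kappa> a]]
      L2_integrable[OF L2_mult_harmonic_density[OF L a]] by simp
  also have "\<dots> = (LINT u|haar. complex_of_real (1 - (cmod a)\<^sup>2) * (u * \<kappa> u * szego_kernel (cnj a) u * u ^ 0))"
  proof (rule Bochner_Integration.integral_cong)
    fix u assume "u \<in> space haar"
    then have "\<kappa> u * ((u - a) * ?P u) =
        \<kappa> u * (complex_of_real (1 - (cmod a)\<^sup>2) * (u * szego_kernel (cnj a) u))"
      using harmonic_density_mult[OF a, of u] by simp
    then show "u * \<kappa> u * ?P u - a * (\<kappa> u * ?P u) =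
        complex_of_real (1 - (cmod a)\<^sup>2) * (u * \<kappa> u * szego_kernel (cnj a) u * u ^ 0)"
      by (simp add: algebra_simps)
  qed simp
  also have "\<dots> = 0"
    using vanishing_moments_mult_szego_kernel[OF vm, of "cnj a"] a
    unfolding integral_mult_right_zero vanishing_moments_def by (metis complex_mod_cnj mult_zero_right)
  finally show ?thesis by simp
qed

lemma integral_power_mult_harmonic_density:
  assumes \<kappa>: "\<kappa> \<in> L2" and vm: "vanishing_moments (\<lambda>u. u * \<kappa> u)" and a: "cmod a < 1"
  shows "(LINT u|haar. u ^ n * \<kappa> u * complex_of_real (harmonic_density a u)) =
    a ^ n * (LINT u|haar. \<kappa> u * complex_of_real (harmonic_density a u))"
proof (induction n)
  case (Suc n)
  have "(LINT u|haar. u * (u ^ n * \<kappa> u) * complex_of_real (harmonic_density a u)) =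
      a * (LINT u|haar. u ^ n * \<kappa> u * complex_of_real (harmonic_density a u))"
  proof (rule integral_ident_mult_harmonic_density[OF _ _ a])
    show "(\<lambda>u. u ^ n * \<kappa> u) \<in> L2" using L2_mult_power[OF \<kappa>, of n] by (simp add: mult.commute)
    show "vanishing_moments (\<lambda>u. u * (u ^ n * \<kappa> u))"
      using vanishing_moments_mult_power[OF vm, of n] by (simp add: mult_ac)
  qed
  then show ?case using Suc by (simp add: mult.assoc)
qed simp

lemma integral_poly_mult_harmonic_density:
  assumes \<kappa>: "\<kappa> \<in> L2" and vm: "vanishing_moments (\<lambda>u. u * \<kappa> u)" and a: "cmod a < 1"
  shows "(LINT u|haar. (\<Sum>n<N. c n * u ^ n) * (\<kappa> u * complex_of_real (harmonic_density a u))) =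
    (\<Sum>n<N. c n * a ^ n) * (LINT u|haar. \<kappa> u * complex_of_real (harmonic_density a u))"
proof -
  let ?P = "\<lambda>u. complex_of_real (harmonic_density a u)"
  have "(LINT u|haar. (\<Sum>n<N. c n * u ^ n) * (\<kappa> u * ?P u)) =
      (LINT u|haar. (\<Sum>n<N. c n * (u ^ n * (\<kappa> u * ?P u))))"
    by (simp add: sum_distrib_right mult.assoc)
  also have "\<dots> = (\<Sum>n<N. (LINT u|haar. c n * (u ^ n * (\<kappa> u * ?P u))))"
    by (intro Bochner_Integration.integral_sum integrable_mult_right L2_mult_integrable power_L2
        L2_mult_harmonic_density \<kappa> a)
  also have "\<dots> = (\<Sum>n<N. c n * (a ^ n * (LINT u|haar. \<kappa> u * ?P u)))"
    using integral_power_mult_harmonic_density[OF \<kappa> vm a] by (simp add: mult.assoc)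
  finally show ?thesis by (simp add: sum_distrib_right mult.assoc)
qed

text \<open>Evaluation of the analytic extension at \<open>a\<close> is multiplicative. For \<open>f\<close> a power this is the
  iteration of \<open>integral_ident_mult_harmonic_density\<close>, and the general case is the \<open>L\<^sup>2\<close> limit of
  polynomials. On \<open>\<kappa>\<close> only moments are imposed, because \<open>\<kappa>\<close> will be the conjugate of an element of
  \<open>H\<^sup>2\<^sub>-\<close>, which is known by orthogonality alone.\<close>

lemma harmonic_density_multiplicative:
  assumes f: "f \<in> H2" and \<kappa>: "\<kappa> \<in> L2" and vm: "vanishing_moments (\<lambda>u. u * \<kappa> u)" and a: "cmod a < 1"
  shows "(LINT u|haar. f u * (\<kappa> u * complex_of_real (harmonic_density a u))) =
    (LINT u|haar. f u * complex_of_real (harmonic_density a u)) *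
    (LINT u|haar. \<kappa> u * complex_of_real (harmonic_density a u))"
proof -
  let ?P = "\<lambda>u. complex_of_real (harmonic_density a u)"
  from f obtain c where fL: "f \<in> L2"
    and lim: "(\<lambda>N. LINT z|haar. (cmod (f z - (\<Sum>n<N. c n * z ^ n)))\<^sup>2) \<longlonglongrightarrow> 0"
    unfolding H2_def by blast
  have one: "(\<lambda>_. 1 :: complex) \<in> L2" using power_L2[of 0] by simp
  have "(\<lambda>N. LINT u|haar. (\<Sum>n<N. c n * u ^ n) * (\<kappa> u * ?P u)) \<longlonglongrightarrow> (LINT u|haar. f u * (\<kappa> u * ?P u))"
    by (rule L2_convergence_integral[OF fL poly_L2 L2_mult_harmonic_density[OF \<kappa> a] lim])
  then have 1: "(\<lambda>N. (\<Sum>n<N. c n * a ^ n) * (LINT u|haar. \<kappa> u * ?P u)) \<longlonglongrightarrow> (LINT u|haar. f u * (\<kappa> u * ?P u))"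
    unfolding integral_poly_mult_harmonic_density[OF \<kappa> vm a] .
  have "(\<lambda>N. LINT u|haar. (\<Sum>n<N. c n * u ^ n) * (1 * ?P u)) \<longlonglongrightarrow> (LINT u|haar. f u * (1 * ?P u))"
    by (rule L2_convergence_integral[OF fL poly_L2 L2_mult_harmonic_density[OF one a] lim])
  moreover have "vanishing_moments (\<lambda>u. u * 1)" using vanishing_moments_ident by simp
  ultimately have "(\<lambda>N. (\<Sum>n<N. c n * a ^ n)) \<longlonglongrightarrow> (LINT u|haar. f u * ?P u)"
    using integral_poly_mult_harmonic_density[OF one _ a, of c] integral_harmonic_density[OF a] by simp
  then have "(\<lambda>N. (\<Sum>n<N. c n * a ^ n) * (LINT u|haar. \<kappa> u * ?P u)) \<longlonglongrightarrow>
      (LINT u|haar. f u * ?P u) * (LINT u|haar. \<kappa> u * ?P u)"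
    by (rule tendsto_mult_right)
  then show ?thesis using 1 LIMSEQ_unique by blast
qed

lemma cnj_borel_measurable [measurable]: "cnj \<in> borel_measurable borel"
  by (rule borel_measurable_continuous_onI) (intro continuous_intros)

text \<open>The recursion \<open>q = 1 + b u q\<close>, integrated against the density at \<open>a\<close>, becomes \<open>I = 1 + b a I\<close>.\<close>

lemma integral_szego_kernel_harmonic_density:
  assumes b: "cmod b < 1" and a: "cmod a < 1"
  shows "(LINT u|haar. szego_kernel b u * complex_of_real (harmonic_density a u)) = szego_kernel b a"
proof -
  let ?q = "szego_kernel b" and ?P = "\<lambda>u. complex_of_real (harmonic_density a u)"
  define I where "I = (LINT u|haar. ?q u * ?P u)"
  have q: "?q \<in> L2" by (rule bounded_L2[OF szego_kernel_measurable szego_kernel_bound[OF b]])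
  have vm: "vanishing_moments (\<lambda>u. u * ?q u)"
    by (rule vanishing_moments_mult_szego_kernel[OF vanishing_moments_ident b])
  then have uq: "(\<lambda>u. u * ?q u) \<in> L2" by (simp add: vanishing_moments_def)
  have one: "(\<lambda>_. 1 :: complex) \<in> L2" using power_L2[of 0] by simp
  have "I = (LINT u|haar. 1 * ?P u + b * (u * ?q u * ?P u))"
    unfolding I_def
  proof (rule Bochner_Integration.integral_cong)
    fix u assume "u \<in> space haar"
    then have "?q u = 1 + b * u * ?q u" by (intro szego_kernel_rec[OF b]) simp
    then have "?q u * ?P u = (1 + b * u * ?q u) * ?P u" by (rule arg_cong)
    then show "?q u * ?P u = 1 * ?P u + b * (u * ?q u * ?P u)" by (simp add: algebra_simps)
  qed simp
  also have "\<dots> = (LINT u|haar. 1 * ?P u) + b * (LINT u|haar. u * ?q u * ?P u)"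
    using L2_integrable[OF L2_mult_harmonic_density[OF uq a]]
      L2_integrable[OF L2_mult_harmonic_density[OF one a]]
    by (subst Bochner_Integration.integral_add) auto
  also have "\<dots> = 1 + b * (a * I)"
    using integral_harmonic_density[OF a] integral_ident_mult_harmonic_density[OF q vm a]
    by (simp add: I_def)
  finally have "(1 - b * a) * I = 1" by (simp add: algebra_simps)
  then have "I = 1 / (1 - b * a)" by (metis mult_zero_left nonzero_mult_div_cancel_left zero_neq_one)
  then show ?thesis by (simp add: I_def szego_kernel_def)
qed

lemma integral_harmonic_density_product:
  assumes b: "cmod b < 1" and a: "cmod a < 1"
  shows "(LINT u|haar. harmonic_density b u * harmonic_density a u) =
    (1 - (cmod b)\<^sup>2 * (cmod a)\<^sup>2) * (cmod (szego_kernel (cnj b) a))\<^sup>2"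
proof -
  let ?q = "szego_kernel (cnj b)" and ?P = "\<lambda>u. complex_of_real (harmonic_density a u)"
  have b': "cmod (cnj b) < 1" using b by simp
  have q: "?q \<in> L2" by (rule bounded_L2[OF szego_kernel_measurable szego_kernel_bound[OF b']])
  have one: "(\<lambda>_. 1 :: complex) \<in> L2" using power_L2[of 0] by simp
  have int: "integrable haar (\<lambda>u. ?q u * ?P u)" "integrable haar ?P"
    "integrable haar (\<lambda>u. cnj (?q u * ?P u))"
    using L2_integrable[OF L2_mult_harmonic_density[OF q a]]
      L2_integrable[OF L2_mult_harmonic_density[OF one a]]
      L2_integrable[OF cnj_L2[OF L2_mult_harmonic_density[OF q a]]] by simp_all
  have lt: "cmod (cnj b * a) < 1"
    using a b by (simp add: norm_mult) (metis abs_norm_cancel abs_mult_less mult_1)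
  have "complex_of_real (LINT u|haar. harmonic_density b u * harmonic_density a u) =
      (LINT u|haar. complex_of_real (harmonic_density b u * harmonic_density a u))"
    by (rule integral_complex_of_real[symmetric])
  also have "\<dots> = (LINT u|haar. (?q u * ?P u + cnj (?q u * ?P u)) - ?P u)"
    by (rule Bochner_Integration.integral_cong) (auto simp: harmonic_density_eq[OF b] algebra_simps)
  also have "\<dots> = (LINT u|haar. ?q u * ?P u) + cnj (LINT u|haar. ?q u * ?P u) - (LINT u|haar. ?P u)"
    unfolding Bochner_Integration.integral_diff[OF Bochner_Integration.integrable_add[OF int(1,3)] int(2)]
      Bochner_Integration.integral_add[OF int(1,3)] Bochner_Integration.integral_cnj ..
  also have "\<dots> = ?q a + cnj (?q a) - 1"
    unfolding integral_szego_kernel_harmonic_density[OF b' a] integral_harmonic_density[OF a] ..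
  also have "\<dots> = complex_of_real ((1 - (cmod (cnj b * a))\<^sup>2) / (cmod (1 - cnj b * a))\<^sup>2)"
    unfolding szego_kernel_def by (rule harmonic_sum_eq[OF lt])
  also have "\<dots> = complex_of_real ((1 - (cmod b)\<^sup>2 * (cmod a)\<^sup>2) * (cmod (?q a))\<^sup>2)"
    by (simp add: szego_kernel_def norm_mult norm_divide power_mult_distrib power_divide)
  finally show ?thesis by (simp only: of_real_eq_iff)
qed

lemma poisson_kernel_eq_harmonic_density:
  assumes "cmod z = 1"
  shows "poisson_kernel r (w * cnj z) = harmonic_density (of_real r * z) w / (2 * pi)"
    and "poisson_kernel r (z * cnj w) = harmonic_density (of_real r * z) w / (2 * pi)"
proof -
  have "cmod (1 - of_real r * (z * cnj w)) = cmod (cnj (1 - of_real r * (z * cnj w)))"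
    by (simp only: complex_mod_cnj)
  then have "cmod (1 - of_real r * (z * cnj w)) = cmod (1 - cnj (of_real r * z) * w)"
    by (simp add: mult_ac)
  then show "poisson_kernel r (z * cnj w) = harmonic_density (of_real r * z) w / (2 * pi)"
    using assms by (simp add: poisson_kernel_def harmonic_density_def norm_mult)
  show "poisson_kernel r (w * cnj z) = harmonic_density (of_real r * z) w / (2 * pi)"
    using assms by (simp add: poisson_kernel_def harmonic_density_def norm_mult mult_ac)
qed

text \<open>The factor \<open>1 / (2 \<pi>)\<close> in the kernel turns \<open>dt\<close> into normalised Haar measure, and the symmetry of the
  kernel lets the point \<open>z\<close> be read as the base point \<open>r z\<close> of a harmonic measure.\<close>

lemma poisson_fun_eq_integral:
  fixes g :: "complex \<Rightarrow> 'a :: {banach, second_countable_topology}"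
  assumes [measurable]: "g \<in> borel_measurable haar" and z: "cmod z = 1"
  shows "poisson_fun r g z = (LINT u|haar. harmonic_density (of_real r * z) u *\<^sub>R g u)"
proof -
  note [measurable] = harmonic_density_measurable
  have "poisson_fun r g z = (LINT t:{0..2 * pi}|lborel. (1 / (2 * pi)) *\<^sub>R
      harmonic_density (of_real r * z) (cis t) *\<^sub>R g (cis t))"
    unfolding poisson_fun_def poisson_kernel_eq_harmonic_density(2)[OF z] by simp
  also have "\<dots> = (2 * pi) *\<^sub>R (LINT u|haar. (1 / (2 * pi)) *\<^sub>R harmonic_density (of_real r * z) u *\<^sub>R g u)"
    by (rule integral_haar) measurable
  also have "\<dots> = (LINT u|haar. harmonic_density (of_real r * z) u *\<^sub>R g u)"
    unfolding integral_scaleR_right by simp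
  finally show ?thesis .
qed

lemma vanishing_moments_cong:
  assumes "\<And>u. cmod u = 1 \<Longrightarrow> f u = g u"
  shows "vanishing_moments f \<longleftrightarrow> vanishing_moments g"
proof -
  have eq: "\<And>u. u \<in> space haar \<Longrightarrow> f u = g u" using assms by simp
  have "f \<in> borel_measurable haar \<longleftrightarrow> g \<in> borel_measurable haar"
    by (rule measurable_cong) (rule eq)
  moreover have "integrable haar (\<lambda>u. (cmod (f u))\<^sup>2) \<longleftrightarrow> integrable haar (\<lambda>u. (cmod (g u))\<^sup>2)"
    by (rule Bochner_Integration.integrable_cong) (auto simp: assms)
  moreover have "(LINT u|haar. f u * u ^ n) = (LINT u|haar. g u * u ^ n)" for n
    by (rule Bochner_Integration.integral_cong) (auto simp: assms)
  ultimately show ?thesis by (simp add: vanishing_moments_def L2_def)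
qed

text \<open>Cauchy-Schwarz after splitting the density into two square roots; its total mass is \<open>1\<close>.\<close>

lemma integral_harmonic_density_bound:
  assumes f: "f \<in> L2" and a: "cmod a < 1"
  shows "(cmod (LINT u|haar. f u * complex_of_real (harmonic_density a u)))\<^sup>2 \<le>
    (LINT u|haar. (cmod (f u))\<^sup>2 * harmonic_density a u)"
proof -
  let ?s = "\<lambda>u. complex_of_real (sqrt (harmonic_density a u))"
  note [measurable] = harmonic_density_measurable[of a] L2_measurable[OF f]
  have sq: "?s u * ?s u = complex_of_real (harmonic_density a u)"
    and csq: "(cmod (?s u))\<^sup>2 = harmonic_density a u" for u
    using harmonic_density_nonneg[OF a, of u] by (simp_all flip: of_real_mult)
  have s: "?s \<in> L2"
  proof (rule bounded_L2)
    fix u :: complex assume "cmod u = 1"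
    then have "sqrt (harmonic_density a u) \<le> sqrt (1 / (1 - cmod a)\<^sup>2)"
      using harmonic_density_bound[OF a] by (intro real_sqrt_le_mono) simp
    then show "cmod (?s u) \<le> sqrt (1 / (1 - cmod a)\<^sup>2)"
      using harmonic_density_nonneg[OF a, of u] by simp
  qed measurable
  have fs: "(\<lambda>u. f u * ?s u) \<in> L2"
  proof (rule L2_mult_bounded[OF f])
    fix u :: complex assume "cmod u = 1"
    then have "sqrt (harmonic_density a u) \<le> sqrt (1 / (1 - cmod a)\<^sup>2)"
      using harmonic_density_bound[OF a] by (intro real_sqrt_le_mono) simp
    then show "cmod (?s u) \<le> sqrt (1 / (1 - cmod a)\<^sup>2)"
      using harmonic_density_nonneg[OF a, of u] by simp
  qed measurable
  have total: "(LINT u|haar. harmonic_density a u) = 1"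
    using integral_harmonic_density[OF a] unfolding integral_complex_of_real
    by (simp only: of_real_eq_1_iff)
  have "(cmod (LINT u|haar. (f u * ?s u) * ?s u))\<^sup>2 \<le>
      (LINT u|haar. (cmod (f u * ?s u))\<^sup>2) * (LINT u|haar. (cmod (?s u))\<^sup>2)"
    by (rule Cauchy_Schwarz_integral) (use s fs in \<open>auto simp: L2_def\<close>)
  then show ?thesis
    unfolding mult.assoc sq norm_mult power_mult_distrib csq total by simp
qed

text \<open>The Schwarz lemma in weighted form. Since \<open>f\<close> vanishes at \<open>0\<close> it is \<open>u \<kappa>\<close> with \<open>\<kappa>\<close> analytic and
  \<open>|\<kappa>| = |f|\<close> on the circle, and evaluation at \<open>a\<close> is multiplicative; what remains is Jensen for the probability
  density at \<open>a\<close>. The factor \<open>|a|\<^sup>2\<close> is what the theorem gains over the plain Cauchy-Schwarz bound.\<close>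

lemma harmonic_extension_at_bound:
  assumes vm: "vanishing_moments f" and a: "cmod a < 1"
  shows "(cmod (LINT u|haar. f u * complex_of_real (harmonic_density a u)))\<^sup>2 \<le>
    (cmod a)\<^sup>2 * (LINT u|haar. (cmod (f u))\<^sup>2 * harmonic_density a u)"
proof -
  define \<kappa> where "\<kappa> u = f u * cnj u" for u
  have f: "f \<in> L2" using vm by (simp add: vanishing_moments_def)
  have \<kappa>: "\<kappa> \<in> L2" unfolding \<kappa>_def[abs_def]
    by (rule L2_mult_bounded[OF f, where B = 1])
      (auto intro: borel_measurable_circle[OF sets_haar])
  have f_eq: "f u = u * \<kappa> u" if "cmod u = 1" for u
    using that complex_norm_square[of u] by (simp add: \<kappa>_def)
  have vm': "vanishing_moments (\<lambda>u. u * \<kappa> u)"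
    using vm vanishing_moments_cong[of f "\<lambda>u. u * \<kappa> u"] f_eq by blast
  have "(LINT u|haar. f u * complex_of_real (harmonic_density a u)) =
      (LINT u|haar. u * \<kappa> u * complex_of_real (harmonic_density a u))"
    by (rule Bochner_Integration.integral_cong) (use f_eq in auto)
  also have "\<dots> = a * (LINT u|haar. \<kappa> u * complex_of_real (harmonic_density a u))"
    by (rule integral_ident_mult_harmonic_density[OF \<kappa> vm' a])
  finally have "(cmod (LINT u|haar. f u * complex_of_real (harmonic_density a u)))\<^sup>2 =
      (cmod a)\<^sup>2 * (cmod (LINT u|haar. \<kappa> u * complex_of_real (harmonic_density a u)))\<^sup>2"
    by (simp add: norm_mult power_mult_distrib)
  also have "\<dots> \<le> (cmod a)\<^sup>2 * (LINT u|haar. (cmod (\<kappa> u))\<^sup>2 * harmonic_density a u)"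
    by (intro mult_left_mono integral_harmonic_density_bound[OF \<kappa> a]) simp
  also have "(LINT u|haar. (cmod (\<kappa> u))\<^sup>2 * harmonic_density a u) =
      (LINT u|haar. (cmod (f u))\<^sup>2 * harmonic_density a u)"
    by (rule Bochner_Integration.integral_cong) (auto simp: \<kappa>_def norm_mult)
  finally show ?thesis .
qed

lemma cnj_szego_kernel_H2_minus:
  assumes b: "cmod b < 1"
  shows "(\<lambda>u. cnj (szego_kernel b u)) \<in> H2_minus"
proof -
  have "L2_inner (\<lambda>u. cnj (szego_kernel b u)) f = 0" if "f \<in> H2_0" for f
  proof -
    have "L2_inner (\<lambda>u. cnj (szego_kernel b u)) f = (LINT u|haar. cnj (f u * szego_kernel b u))"
      by (simp add: L2_inner_def mult.commute)
    also have "\<dots> = cnj (LINT u|haar. f u * szego_kernel b u * u ^ 0)"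
      by (subst Bochner_Integration.integral_cnj) simp
    also have "\<dots> = 0"
      using vanishing_moments_mult_szego_kernel[OF H2_0_vanishing_moments[OF that] b]
      unfolding vanishing_moments_def by (metis complex_cnj_zero)
    finally show ?thesis .
  qed
  moreover have "szego_kernel b \<in> L2"
    by (rule bounded_L2[OF szego_kernel_measurable szego_kernel_bound[OF b]])
  ultimately show ?thesis by (simp add: H2_minus_def cnj_L2)
qed

text \<open>Conjugated kernel and harmonic density differ by \<open>cnj a u / (1 - cnj a u)\<close>, which has
  only positive modes and so is invisible to \<open>\<kappa>\<close>.\<close>

lemma integral_cnj_szego_kernel:
  assumes \<kappa>: "\<kappa> \<in> L2" and vm: "vanishing_moments (\<lambda>u. u * \<kappa> u)" and a: "cmod a < 1"
  shows "(LINT u|haar. cnj (szego_kernel (cnj a) u) * \<kappa> u) =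
    (LINT u|haar. \<kappa> u * complex_of_real (harmonic_density a u))"
proof -
  let ?q = "szego_kernel (cnj a)"
  have a': "cmod (cnj a) < 1" using a by simp
  have q: "?q \<in> L2" by (rule bounded_L2[OF szego_kernel_measurable szego_kernel_bound[OF a']])
  have vmq: "vanishing_moments (\<lambda>u. u * \<kappa> u * ?q u)"
    by (rule vanishing_moments_mult_szego_kernel[OF vm a'])
  then have zero: "(LINT u|haar. u * \<kappa> u * ?q u) = 0" and int: "integrable haar (\<lambda>u. u * \<kappa> u * ?q u)"
    unfolding vanishing_moments_def using L2_integrable by (auto dest: spec[of _ 0])
  have int': "integrable haar (\<lambda>u. cnj (?q u) * \<kappa> u)"
    by (rule L2_mult_integrable[OF cnj_L2[OF q] \<kappa>])
  have "(LINT u|haar. \<kappa> u * complex_of_real (harmonic_density a u)) =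
      (LINT u|haar. cnj (?q u) * \<kappa> u + cnj a * (u * \<kappa> u * ?q u))"
  proof (rule Bochner_Integration.integral_cong)
    fix u assume "u \<in> space haar"
    then have u: "cmod u = 1" by simp
    have "complex_of_real (harmonic_density a u) = ?q u + cnj (?q u) - 1"
      by (rule harmonic_density_eq[OF a u])
    also have "?q u + cnj (?q u) - 1 = cnj a * u * ?q u + cnj (?q u)"
      using szego_kernel_rec[OF a' u] by (metis add.commute add_diff_cancel_left' add_diff_eq)
    finally show "\<kappa> u * complex_of_real (harmonic_density a u) =
        cnj (?q u) * \<kappa> u + cnj a * (u * \<kappa> u * ?q u)"
      by (simp add: algebra_simps)
  qed simp
  also have "\<dots> = (LINT u|haar. cnj (?q u) * \<kappa> u)"
    using int int' zero by simp
  finally show ?thesis ..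
qed

section \<open>Weights that are superpositions of harmonic densities\<close>

text \<open>The superposition \<open>\<phi> = 1 / (2 \<pi>) \<integral> P\<^sub>a d\<mu>(w)\<close> of harmonic densities with base points \<open>a = \<rho> w\<close>. For
  a single base point the Hankel operator sends every element of \<open>H\<^sup>2\<^sub>0\<close> to a multiple of
  \<open>1 / (1 - a cnj u) = u / (u - a)\<close>.\<close>

locale poisson_weight = finite_measure \<mu> for \<mu> :: "complex measure" +
  fixes \<rho> :: real and \<phi> :: "complex \<Rightarrow> real"
  assumes sets_\<mu> [measurable_cong]: "sets \<mu> = sets circle_borel"
    and \<rho>: "0 \<le> \<rho>" "\<rho> < 1"
    and \<phi>_eq: "\<And>z. cmod z = 1 \<Longrightarrow> \<phi> z = poisson_measure \<rho> \<mu> z"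
begin

abbreviation pole :: "complex \<Rightarrow> complex" where
  "pole w \<equiv> of_real \<rho> * w"

lemma space_\<mu>: "space \<mu> = sphere 0 1"
  using sets_eq_imp_space_eq[OF sets_\<mu>] by (simp add: space_restrict_space)

lemma cmod_pole: "cmod w = 1 \<Longrightarrow> cmod (pole w) = \<rho>"
  using \<rho> by (simp add: norm_mult)

lemma cmod_pole_less: "cmod w = 1 \<Longrightarrow> cmod (pole w) < 1"
  using \<rho> cmod_pole by simp

lemma fst_measurable [measurable]: "fst \<in> borel_measurable (\<mu> \<Otimes>\<^sub>M haar)"
  by (rule measurable_compose[OF measurable_fst borel_measurable_circle[OF sets_\<mu> measurable_ident_sets[OF refl]]])

lemma snd_measurable [measurable]: "snd \<in> borel_measurable (\<mu> \<Otimes>\<^sub>M haar)"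
  by (rule measurable_compose[OF measurable_snd borel_measurable_circle[OF sets_haar measurable_ident_sets[OF refl]]])

lemma \<phi>_eq_integral:
  assumes "cmod z = 1"
  shows "\<phi> z = (LINT w|\<mu>. harmonic_density (pole w) z / (2 * pi))"
  unfolding \<phi>_eq[OF assms] poisson_measure_def
  by (rule Bochner_Integration.integral_cong) (auto simp: space_\<mu> poisson_kernel_eq_harmonic_density)

lemma harmonic_density_pole_bound:
  assumes "cmod w = 1" "cmod u = 1"
  shows "\<bar>harmonic_density (pole w) u\<bar> \<le> 1 / (1 - \<rho>)\<^sup>2"
  using harmonic_density_bound[OF cmod_pole_less, of w u] harmonic_density_nonneg[OF cmod_pole_less, of w u]
    cmod_pole[of w] assms by simp

text \<open>Every integral against the weight reduces to the case of a single base point.\<close>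

lemma weight_integral:
  fixes g :: "complex \<Rightarrow> 'a :: {banach, second_countable_topology}"
  assumes g: "integrable haar g"
  shows "(LINT u|haar. \<phi> u *\<^sub>R g u) =
      (1 / (2 * pi)) *\<^sub>R (LINT w|\<mu>. LINT u|haar. harmonic_density (pole w) u *\<^sub>R g u)"
    and "integrable \<mu> (\<lambda>w. LINT u|haar. harmonic_density (pole w) u *\<^sub>R g u)"
    and "integrable haar (\<lambda>u. \<phi> u *\<^sub>R g u)"
proof -
  let ?k = "\<lambda>w u. harmonic_density (pole w) u *\<^sub>R g u"
  have [measurable]: "g \<in> borel_measurable haar" using g by simp
  have m: "(\<lambda>(w, u). ?k w u) \<in> borel_measurable (\<mu> \<Otimes>\<^sub>M haar)"
    unfolding harmonic_density_def case_prod_beta by measurable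
  have dom: "integrable haar (\<lambda>u. 1 / (1 - \<rho>)\<^sup>2 * norm (g u))" using g by simp
  have bound: "norm (?k w u) \<le> 1 / (1 - \<rho>)\<^sup>2 * norm (g u)" if "w \<in> space \<mu>" "u \<in> space haar" for w u
    using that harmonic_density_pole_bound[of w u] unfolding norm_scaleR space_\<mu> space_haar
    by (intro mult_right_mono) auto
  note fub = Fubini_dominated[OF finite_measure_axioms haar.finite_measure_axioms m dom bound]
  have eq: "\<phi> u *\<^sub>R g u = (1 / (2 * pi)) *\<^sub>R (LINT w|\<mu>. ?k w u)" if "u \<in> space haar" for u
  proof -
    have "(\<lambda>w. harmonic_density (pole w) u) \<in> borel_measurable \<mu>"
      unfolding harmonic_density_def
      by (rule borel_measurable_circle[OF sets_\<mu>]) measurable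
    moreover have "AE w in \<mu>. norm (harmonic_density (pole w) u) \<le> 1 / (1 - \<rho>)\<^sup>2"
      using that harmonic_density_pole_bound[of _ u] by (intro AE_I2) (simp add: space_\<mu>)
    ultimately have "integrable \<mu> (\<lambda>w. harmonic_density (pole w) u)"
      by (intro integrable_const_bound)
    then have "(LINT w|\<mu>. ?k w u) = (LINT w|\<mu>. harmonic_density (pole w) u) *\<^sub>R g u"
      by simp
    then show ?thesis using \<phi>_eq_integral[of u] that by simp
  qed
  have "(LINT u|haar. \<phi> u *\<^sub>R g u) = (LINT u|haar. (1 / (2 * pi)) *\<^sub>R (LINT w|\<mu>. ?k w u))"
    by (rule Bochner_Integration.integral_cong[OF refl eq])
  also have "\<dots> = (1 / (2 * pi)) *\<^sub>R (LINT u|haar. LINT w|\<mu>. ?k w u)"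
    by (rule integral_scaleR_right)
  also have "(LINT u|haar. LINT w|\<mu>. ?k w u) = (LINT w|\<mu>. LINT u|haar. ?k w u)"
    by (rule fub(1))
  finally show "(LINT u|haar. \<phi> u *\<^sub>R g u) = (1 / (2 * pi)) *\<^sub>R (LINT w|\<mu>. LINT u|haar. ?k w u)" .
  show "integrable \<mu> (\<lambda>w. LINT u|haar. ?k w u)" by (rule fub(2))
  show "integrable haar (\<lambda>u. \<phi> u *\<^sub>R g u)"
  proof -
    have "integrable haar (\<lambda>u. LINT w|\<mu>. ?k w u)" by (rule fub(3))
    then have "integrable haar (\<lambda>u. (1 / (2 * pi)) *\<^sub>R (LINT w|\<mu>. ?k w u))" by simp
    moreover have "integrable haar (\<lambda>u. \<phi> u *\<^sub>R g u) \<longleftrightarrow>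
        integrable haar (\<lambda>u. (1 / (2 * pi)) *\<^sub>R (LINT w|\<mu>. ?k w u))"
      by (rule Bochner_Integration.integrable_cong[OF refl eq])
    ultimately show ?thesis by blast
  qed
qed

lemma \<phi>_measurable: "\<phi> \<in> borel_measurable haar"
  using weight_integral(3)[of "\<lambda>_. 1 :: real"] by simp

lemma \<phi>_bound:
  assumes "cmod z = 1"
  shows "\<bar>\<phi> z\<bar> \<le> (LINT w|\<mu>. 1 / (1 - \<rho>)\<^sup>2 / (2 * pi))"
proof -
  have "\<bar>\<phi> z\<bar> \<le> (LINT w|\<mu>. norm (harmonic_density (pole w) z / (2 * pi)))"
    unfolding \<phi>_eq_integral[OF assms] using integral_norm_bound by (metis real_norm_def)
  also have "\<dots> \<le> (LINT w|\<mu>. 1 / (1 - \<rho>)\<^sup>2 / (2 * pi))"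
  proof (rule integral_mono')
    fix w assume "w \<in> space \<mu>"
    then have "\<bar>harmonic_density (pole w) z\<bar> / (2 * pi) \<le> 1 / (1 - \<rho>)\<^sup>2 / (2 * pi)"
      using harmonic_density_pole_bound[of w z] assms by (intro divide_right_mono) (auto simp: space_\<mu>)
    then show "norm (harmonic_density (pole w) z / (2 * pi)) \<le> 1 / (1 - \<rho>)\<^sup>2 / (2 * pi)"
      by (simp only: real_norm_def abs_divide) simp
  qed auto
  finally show ?thesis .
qed

lemma weight_nonneg: "cmod z = 1 \<Longrightarrow> 0 \<le> \<phi> z"
  unfolding \<phi>_eq_integral by (intro integral_nonneg_AE AE_I2)
    (use harmonic_density_nonneg[OF cmod_pole_less] in \<open>simp add: space_\<mu>\<close>)

lemma weight_mult_L2: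
  assumes "f \<in> L2"
  shows "(\<lambda>u. complex_of_real (\<phi> u) * f u) \<in> L2"
proof -
  have "(\<lambda>u. f u * complex_of_real (\<phi> u)) \<in> L2"
  proof (rule L2_mult_bounded[OF assms])
    show "(\<lambda>u. complex_of_real (\<phi> u)) \<in> borel_measurable haar" using \<phi>_measurable by measurable
    show "cmod (complex_of_real (\<phi> u)) \<le> (LINT w|\<mu>. 1 / (1 - \<rho>)\<^sup>2 / (2 * pi))" if "cmod u = 1" for u
      using \<phi>_bound[OF that] by (simp only: norm_of_real)
  qed
  then show ?thesis by (simp only: mult.commute)
qed

definition pole_value :: "(complex \<Rightarrow> complex) \<Rightarrow> complex \<Rightarrow> complex" where
  "pole_value f w = (LINT u|haar. f u * complex_of_real (harmonic_density (pole w) u))"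

text \<open>The antianalytic part of \<open>P\<^sub>a f\<close> is \<open>f(a) / (1 - a cnj u)\<close>; this is its superposition over \<open>\<mu>\<close>.\<close>

definition hankel_image :: "(complex \<Rightarrow> complex) \<Rightarrow> complex \<Rightarrow> complex" where
  "hankel_image f u = (LINT w|\<mu>. pole_value f w * cnj (szego_kernel (cnj (pole w)) u)) / (2 * pi)"

lemma integral_weight_mult:
  assumes "integrable haar f"
  shows "(LINT u|haar. complex_of_real (\<phi> u) * f u) = (LINT w|\<mu>. pole_value f w) / (2 * pi)"
  using weight_integral(1)[OF assms]
  by (simp add: pole_value_def scaleR_conv_of_real mult.commute)

lemma pole_value_measurable:
  "f \<in> L2 \<Longrightarrow> pole_value f \<in> borel_measurable \<mu>"
  using weight_integral(2)[OF L2_integrable, of f]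
  by (auto simp: pole_value_def[abs_def] scaleR_conv_of_real mult.commute)

lemma pole_value_bound:
  assumes f: "f \<in> L2" and w: "cmod w = 1"
  shows "cmod (pole_value f w) \<le> (LINT u|haar. 1 / (1 - \<rho>)\<^sup>2 * cmod (f u))"
  unfolding pole_value_def
proof (rule order_trans[OF integral_norm_bound integral_mono'])
  show "integrable haar (\<lambda>u. 1 / (1 - \<rho>)\<^sup>2 * cmod (f u))" using L2_integrable[OF f] by simp
  fix u assume "u \<in> space haar"
  then show "cmod (f u * complex_of_real (harmonic_density (pole w) u)) \<le> 1 / (1 - \<rho>)\<^sup>2 * cmod (f u)"
    using mult_right_mono[OF harmonic_density_pole_bound[OF w, of u], of "cmod (f u)"]
    by (simp add: norm_mult mult.commute)
qed simp

lemma hankel_image_integral: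
  assumes f: "f \<in> L2" and \<kappa>: "integrable haar \<kappa>"
  shows "(LINT u|haar. hankel_image f u * \<kappa> u) =
      (LINT w|\<mu>. pole_value f w * (LINT u|haar. cnj (szego_kernel (cnj (pole w)) u) * \<kappa> u)) / (2 * pi)"
    and "integrable haar (\<lambda>u. hankel_image f u * \<kappa> u)"
proof -
  define k where "k w u = pole_value f w * cnj (szego_kernel (cnj (pole w)) u) * \<kappa> u" for w u
  define B where "B = (LINT u|haar. 1 / (1 - \<rho>)\<^sup>2 * cmod (f u)) * (1 / (1 - \<rho>))"
  have [measurable]: "\<kappa> \<in> borel_measurable haar" using \<kappa> by simp
  note [measurable] = pole_value_measurable[OF f]
  have m: "(\<lambda>(w, u). k w u) \<in> borel_measurable (\<mu> \<Otimes>\<^sub>M haar)"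
    unfolding k_def szego_kernel_def case_prod_beta by measurable
  have szego: "cmod (cnj (szego_kernel (cnj (pole w)) u)) \<le> 1 / (1 - \<rho>)"
    if "cmod w = 1" "cmod u = 1" for w u
    using szego_kernel_bound[of "cnj (pole w)" u] cmod_pole[of "cnj w"] \<rho> that by simp
  have dom: "integrable haar (\<lambda>u. B * cmod (\<kappa> u))" using \<kappa> by simp
  have bound: "norm (k w u) \<le> B * cmod (\<kappa> u)" if "w \<in> space \<mu>" "u \<in> space haar" for w u
    unfolding k_def B_def norm_mult using that szego[of w u] pole_value_bound[OF f, of w]
    by (intro mult_right_mono mult_mono) (auto simp: space_\<mu> intro!: integral_nonneg_AE)
  note fub = Fubini_dominated[OF finite_measure_axioms haar.finite_measure_axioms m dom bound]
  have "(LINT w|\<mu>. k w u) = (LINT w|\<mu>. pole_value f w * cnj (szego_kernel (cnj (pole w)) u)) * \<kappa> u" for u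
    unfolding k_def by simp
  then have eq: "hankel_image f u * \<kappa> u = (LINT w|\<mu>. k w u) / (2 * pi)" for u
    by (simp add: hankel_image_def)
  show "integrable haar (\<lambda>u. hankel_image f u * \<kappa> u)"
    unfolding eq using fub(3) by simp
  show "(LINT u|haar. hankel_image f u * \<kappa> u) =
      (LINT w|\<mu>. pole_value f w * (LINT u|haar. cnj (szego_kernel (cnj (pole w)) u) * \<kappa> u)) / (2 * pi)"
  proof -
    have "(LINT u|haar. hankel_image f u * \<kappa> u) = (LINT u|haar. LINT w|\<mu>. k w u) / (2 * pi)"
      unfolding eq by (rule integral_divide_zero)
    also have "(LINT u|haar. LINT w|\<mu>. k w u) = (LINT w|\<mu>. LINT u|haar. k w u)"
      by (rule fub(1))
    also have "\<dots> = (LINT w|\<mu>. pole_value f w * (LINT u|haar. cnj (szego_kernel (cnj (pole w)) u) * \<kappa> u))"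
      unfolding k_def mult.assoc integral_mult_right_zero ..
    finally show ?thesis .
  qed
qed

lemma hankel_image_L2:
  assumes f: "f \<in> L2"
  shows "hankel_image f \<in> L2"
proof (rule bounded_L2)
  let ?B = "(LINT u|haar. 1 / (1 - \<rho>)\<^sup>2 * cmod (f u)) * (1 / (1 - \<rho>))"
  show "hankel_image f \<in> borel_measurable haar"
    using hankel_image_integral(2)[OF f, of "\<lambda>_. 1"] by simp
  fix u :: complex assume u: "cmod u = 1"
  have "0 \<le> ?B" using \<rho> by (intro mult_nonneg_nonneg integral_nonneg_AE) auto
  have "cmod (LINT w|\<mu>. pole_value f w * cnj (szego_kernel (cnj (pole w)) u)) \<le> (LINT w|\<mu>. ?B)"
  proof (rule order_trans[OF integral_norm_bound integral_mono'])
    fix w assume "w \<in> space \<mu>"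
    then show "cmod (pole_value f w * cnj (szego_kernel (cnj (pole w)) u)) \<le> ?B"
      unfolding norm_mult
      using szego_kernel_bound[of "cnj (pole w)" u] cmod_pole[of "cnj w"] \<rho> u
        pole_value_bound[OF f, of w]
      by (intro mult_mono) (auto simp: space_\<mu> intro!: integral_nonneg_AE)
  qed (use \<open>0 \<le> ?B\<close> in simp_all)
  then have "cmod (LINT w|\<mu>. pole_value f w * cnj (szego_kernel (cnj (pole w)) u)) / (2 * pi)
      \<le> (LINT w|\<mu>. ?B) / (2 * pi)"
    by (intro divide_right_mono) auto
  then show "cmod (hankel_image f u) \<le> (LINT w|\<mu>. ?B) / (2 * pi)"
    unfolding hankel_image_def norm_divide by simp
qed

lemma hankel_image_H2_minus:
  assumes f: "f \<in> L2"
  shows "hankel_image f \<in> H2_minus"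
proof -
  have "L2_inner (hankel_image f) g = 0" if g: "g \<in> H2_0" for g
  proof -
    have gL: "g \<in> L2" using g by (simp add: H2_0_def H2_def)
    have "(LINT w|\<mu>. pole_value f w * (LINT u|haar. cnj (szego_kernel (cnj (pole w)) u) * cnj (g u)))
        = (LINT w|\<mu>. 0)"
    proof (rule Bochner_Integration.integral_cong)
      fix w assume "w \<in> space \<mu>"
      then have "cmod (cnj (pole w)) < 1" using cmod_pole_less[of "cnj w"] by (simp add: space_\<mu>)
      then have "L2_inner (\<lambda>u. cnj (szego_kernel (cnj (pole w)) u)) g = 0"
        using cnj_szego_kernel_H2_minus g unfolding H2_minus_def by blast
      then show "pole_value f w * (LINT u|haar. cnj (szego_kernel (cnj (pole w)) u) * cnj (g u)) = 0"
        by (simp add: L2_inner_def)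
    qed simp
    then show ?thesis
      unfolding L2_inner_def
      using hankel_image_integral(1)[OF f L2_integrable[OF cnj_L2[OF gL]]] by simp
  qed
  then show ?thesis using hankel_image_L2[OF f] by (simp add: H2_minus_def)
qed

text \<open>For each base point \<open>a\<close>, the pairing of \<open>P\<^sub>a f\<close> with \<open>k\<close> is, by multiplicativity, the product of the values of
  \<open>f\<close> and of \<open>cnj k\<close> at \<open>a\<close>. The value of \<open>cnj k\<close> is also the pairing of \<open>1 / (1 - a cnj u)\<close> with \<open>k\<close>.\<close>

lemma hankel_image_residual:
  assumes f: "f \<in> H2_0" and k: "k \<in> H2_minus"
  shows "L2_inner (\<lambda>u. complex_of_real (\<phi> u) * f u - hankel_image f u) k = 0"
proof -
  have fH: "f \<in> H2" and fL: "f \<in> L2" using f by (auto simp: H2_0_def H2_def)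
  have kL: "k \<in> L2" using k by (simp add: H2_minus_def)
  define \<kappa> where "\<kappa> u = cnj (k u)" for u
  have \<kappa>: "\<kappa> \<in> L2" unfolding \<kappa>_def[abs_def] by (rule cnj_L2[OF kL])
  have vm: "vanishing_moments (\<lambda>u. u * \<kappa> u)"
    unfolding \<kappa>_def by (rule H2_minus_vanishing_moments[OF k])
  have "(LINT u|haar. complex_of_real (\<phi> u) * (f u * \<kappa> u)) =
      (LINT w|\<mu>. pole_value (\<lambda>u. f u * \<kappa> u) w) / (2 * pi)"
    by (rule integral_weight_mult[OF L2_mult_integrable[OF fL \<kappa>]])
  also have "(LINT w|\<mu>. pole_value (\<lambda>u. f u * \<kappa> u) w) =
      (LINT w|\<mu>. pole_value f w * (LINT u|haar. cnj (szego_kernel (cnj (pole w)) u) * \<kappa> u))"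
  proof (rule Bochner_Integration.integral_cong)
    fix w assume "w \<in> space \<mu>"
    then have a: "cmod (pole w) < 1" using cmod_pole_less by (simp add: space_\<mu>)
    show "pole_value (\<lambda>u. f u * \<kappa> u) w =
        pole_value f w * (LINT u|haar. cnj (szego_kernel (cnj (pole w)) u) * \<kappa> u)"
      unfolding pole_value_def integral_cnj_szego_kernel[OF \<kappa> vm a] mult.assoc
      by (rule harmonic_density_multiplicative[OF fH \<kappa> vm a])
  qed simp
  also have "\<dots> / (2 * pi) = (LINT u|haar. hankel_image f u * \<kappa> u)"
    by (rule hankel_image_integral(1)[OF fL L2_integrable[OF \<kappa>], symmetric])
  finally have eq: "(LINT u|haar. complex_of_real (\<phi> u) * (f u * \<kappa> u)) =
      (LINT u|haar. hankel_image f u * \<kappa> u)" .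
  have "integrable haar (\<lambda>u. complex_of_real (\<phi> u) * (f u * \<kappa> u))"
    using L2_mult_integrable[OF weight_mult_L2[OF fL] \<kappa>] by (simp add: mult.assoc)
  then have "(LINT u|haar. complex_of_real (\<phi> u) * (f u * \<kappa> u) - hankel_image f u * \<kappa> u) = 0"
    using eq hankel_image_integral(2)[OF fL L2_integrable[OF \<kappa>]] by simp
  then show ?thesis by (simp add: L2_inner_def \<kappa>_def algebra_simps)
qed

text \<open>The projection is defined by an arbitrary choice; the explicit \<open>hankel_image\<close> serves only to show that
  there is something to choose, and all later arguments use the two orthogonality relations.\<close>

lemma hankel_characterisation:
  assumes f: "f \<in> H2_0"
  defines "h \<equiv> hankel (\<lambda>w. complex_of_real (\<phi> w)) f"
  shows "h \<in> H2_minus"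
    and "\<And>k. k \<in> H2_minus \<Longrightarrow> L2_inner (\<lambda>u. complex_of_real (\<phi> u) * f u - h u) k = 0"
proof -
  have "f \<in> L2" using f by (auto simp: H2_0_def H2_def)
  then have "\<exists>h. h \<in> H2_minus \<and> (\<forall>k\<in>H2_minus. L2_inner (\<lambda>u. complex_of_real (\<phi> u) * f u - h u) k = 0)"
    using hankel_image_H2_minus hankel_image_residual[OF f] by blast
  from someI_ex[OF this]
  show "h \<in> H2_minus" "\<And>k. k \<in> H2_minus \<Longrightarrow> L2_inner (\<lambda>u. complex_of_real (\<phi> u) * f u - h u) k = 0"
    unfolding h_def hankel_def R_minus_def by blast+
qed

end

text \<open>The analytic half of the density pairs to \<open>0\<close> with \<open>h\<close>, except for its constant term.\<close>

lemma integral_harmonic_density_H2_minus: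
  assumes h: "h \<in> H2_minus" and b: "cmod b < 1"
  shows "(LINT u|haar. harmonic_density b u *\<^sub>R h u) = L2_inner h (\<lambda>u. cnj (szego_kernel (cnj b) u))"
proof -
  have hL: "h \<in> L2" using h by (simp add: H2_minus_def)
  have "(LINT u|haar. harmonic_density b u *\<^sub>R h u) =
      cnj (LINT u|haar. cnj (h u) * complex_of_real (harmonic_density b u))"
    unfolding Bochner_Integration.integral_cnj[symmetric] by (simp add: scaleR_conv_of_real mult.commute)
  also have "\<dots> = cnj (LINT u|haar. cnj (szego_kernel (cnj b) u) * cnj (h u))"
    unfolding integral_cnj_szego_kernel[OF cnj_L2[OF hL] H2_minus_vanishing_moments[OF h] b] ..
  also have "\<dots> = L2_inner h (\<lambda>u. cnj (szego_kernel (cnj b) u))"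
    unfolding Bochner_Integration.integral_cnj[symmetric] L2_inner_def by (simp add: mult.commute)
  finally show ?thesis .
qed

context poisson_weight
begin

text \<open>The smoothed Hankel image at \<open>z\<close> is a pairing with an element of \<open>H\<^sup>2\<^sub>-\<close>, so the projection may be
  dropped from it; multiplicativity at each base point then evaluates the integral.\<close>

lemma poisson_fun_hankel:
  assumes f: "f \<in> H2_0" and s: "0 \<le> s" "s < 1" and z: "cmod z = 1"
  shows "poisson_fun s (hankel (\<lambda>w. complex_of_real (\<phi> w)) f) z =
    (LINT w|\<mu>. pole_value f w * szego_kernel (cnj (of_real s * z)) (pole w)) / (2 * pi)"
proof -
  let ?b = "of_real s * z" and ?h = "hankel (\<lambda>w. complex_of_real (\<phi> w)) f"
  let ?q = "szego_kernel (cnj ?b)"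
  have fH: "f \<in> H2" and fL: "f \<in> L2" using f by (auto simp: H2_0_def H2_def)
  have b: "cmod ?b < 1" and b': "cmod (cnj ?b) < 1" using s z by (simp_all add: norm_mult)
  have hL: "?h \<in> L2" using hankel_characterisation(1)[OF f] by (simp add: H2_minus_def)
  have q: "?q \<in> L2" by (rule bounded_L2[OF szego_kernel_measurable szego_kernel_bound[OF b']])
  have vm: "vanishing_moments (\<lambda>u. u * ?q u)"
    by (rule vanishing_moments_mult_szego_kernel[OF vanishing_moments_ident b'])
  have "poisson_fun s ?h z = (LINT u|haar. ?h u * ?q u)"
    using poisson_fun_eq_integral[OF L2_measurable[OF hL] z, of s]
      integral_harmonic_density_H2_minus[OF hankel_characterisation(1)[OF f] b]
    by (simp add: L2_inner_def)
  also have "\<dots> = (LINT u|haar. complex_of_real (\<phi> u) * f u * ?q u)"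
    using hankel_characterisation(2)[OF f cnj_szego_kernel_H2_minus[OF b']]
      L2_mult_integrable[OF weight_mult_L2[OF fL] q] L2_mult_integrable[OF hL q]
    by (simp add: L2_inner_def algebra_simps)
  also have "\<dots> = (LINT w|\<mu>. pole_value (\<lambda>u. f u * ?q u) w) / (2 * pi)"
    using integral_weight_mult[OF L2_mult_integrable[OF fL q]] by (simp add: mult.assoc)
  also have "(LINT w|\<mu>. pole_value (\<lambda>u. f u * ?q u) w) = (LINT w|\<mu>. pole_value f w * ?q (pole w))"
  proof (rule Bochner_Integration.integral_cong)
    fix w assume "w \<in> space \<mu>"
    then have a: "cmod (pole w) < 1" using cmod_pole_less by (simp add: space_\<mu>)
    show "pole_value (\<lambda>u. f u * ?q u) w = pole_value f w * ?q (pole w)"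
      unfolding pole_value_def mult.assoc integral_szego_kernel_harmonic_density[OF b' a, symmetric]
      by (rule harmonic_density_multiplicative[OF fH q vm a])
  qed simp
  finally show ?thesis .
qed

lemma poisson_fun_weight:
  assumes s: "0 \<le> s" "s < 1" and z: "cmod z = 1"
  shows "poisson_fun s \<phi> z =
    (1 - s\<^sup>2 * \<rho>\<^sup>2) * (LINT w|\<mu>. (cmod (szego_kernel (cnj (of_real s * z)) (pole w)))\<^sup>2) / (2 * pi)"
proof -
  let ?b = "of_real s * z"
  have b: "cmod ?b < 1" and b_eq: "cmod ?b = s" using s z by (simp_all add: norm_mult)
  have one: "(\<lambda>_. 1 :: complex) \<in> L2" using power_L2[of 0] by simp
  have "integrable haar (\<lambda>u. complex_of_real (harmonic_density ?b u))"
    using L2_integrable[OF L2_mult_harmonic_density[OF one b]] by simp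
  then have int: "integrable haar (harmonic_density ?b)"
    using complex_of_real_integrable_eq by blast
  have "poisson_fun s \<phi> z = (LINT u|haar. \<phi> u *\<^sub>R harmonic_density ?b u)"
    unfolding poisson_fun_eq_integral[OF \<phi>_measurable z] by (simp add: mult.commute)
  also have "\<dots> = (LINT w|\<mu>. LINT u|haar. harmonic_density (pole w) u *\<^sub>R harmonic_density ?b u) / (2 * pi)"
    unfolding weight_integral(1)[OF int] by simp
  also have "(LINT w|\<mu>. LINT u|haar. harmonic_density (pole w) u *\<^sub>R harmonic_density ?b u) =
      (LINT w|\<mu>. (1 - s\<^sup>2 * \<rho>\<^sup>2) * (cmod (szego_kernel (cnj ?b) (pole w)))\<^sup>2)"
  proof (rule Bochner_Integration.integral_cong)
    fix w assume "w \<in> space \<mu>"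
    then have a: "cmod (pole w) < 1" and a_eq: "cmod (pole w) = \<rho>"
      using cmod_pole_less cmod_pole by (simp_all add: space_\<mu>)
    show "(LINT u|haar. harmonic_density (pole w) u *\<^sub>R harmonic_density ?b u) =
        (1 - s\<^sup>2 * \<rho>\<^sup>2) * (cmod (szego_kernel (cnj ?b) (pole w)))\<^sup>2"
      using integral_harmonic_density_product[OF b a] unfolding a_eq b_eq by (simp add: mult.commute)
  qed simp
  finally show ?thesis by simp
qed

lemma integral_pole_value_bound:
  assumes f: "f \<in> H2_0"
  shows "integrable \<mu> (\<lambda>w. (cmod (pole_value f w))\<^sup>2)"
    and "(LINT w|\<mu>. (cmod (pole_value f w))\<^sup>2) \<le> 2 * pi * \<rho>\<^sup>2 * (LINT u|haar. (cmod (f u))\<^sup>2 * \<phi> u)"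
proof -
  have fL: "f \<in> L2" using f by (auto simp: H2_0_def H2_def)
  note [measurable] = pole_value_measurable[OF fL]
  have int: "integrable haar (\<lambda>u. (cmod (f u))\<^sup>2)" using fL by (simp add: L2_def)
  let ?m = "\<lambda>w. LINT u|haar. harmonic_density (pole w) u *\<^sub>R (cmod (f u))\<^sup>2"
  have int_m: "integrable \<mu> (\<lambda>w. \<rho>\<^sup>2 * ?m w)" using weight_integral(2)[OF int] by simp
  have le: "(cmod (pole_value f w))\<^sup>2 \<le> \<rho>\<^sup>2 * ?m w" if "w \<in> space \<mu>" for w
    using harmonic_extension_at_bound[OF H2_0_vanishing_moments[OF f] cmod_pole_less, of w] cmod_pole[of w] that
    by (simp add: pole_value_def space_\<mu> mult.commute)
  show int': "integrable \<mu> (\<lambda>w. (cmod (pole_value f w))\<^sup>2)"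
  proof (rule Bochner_Integration.integrable_bound[OF int_m])
    show "AE w in \<mu>. norm ((cmod (pole_value f w))\<^sup>2) \<le> norm (\<rho>\<^sup>2 * ?m w)"
      using order_trans[OF le abs_ge_self] by (intro AE_I2) (simp only: real_norm_def abs_power2)
  qed measurable
  have "(LINT w|\<mu>. (cmod (pole_value f w))\<^sup>2) \<le> (LINT w|\<mu>. \<rho>\<^sup>2 * ?m w)"
    by (rule integral_mono[OF int' int_m le])
  also have "\<dots> = 2 * pi * \<rho>\<^sup>2 * (LINT u|haar. \<phi> u *\<^sub>R (cmod (f u))\<^sup>2)"
    unfolding weight_integral(1)[OF int] by simp
  finally show "(LINT w|\<mu>. (cmod (pole_value f w))\<^sup>2) \<le>
      2 * pi * \<rho>\<^sup>2 * (LINT u|haar. (cmod (f u))\<^sup>2 * \<phi> u)"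
    by (simp add: mult.commute)
qed

lemma szego_kernel_pole_bound:
  assumes s: "0 \<le> s" "s < 1" and "cmod z = 1" "cmod w = 1"
  shows "cmod (szego_kernel (cnj (of_real s * z)) (pole w)) \<le> 1 / (1 - s)"
proof -
  have "cmod (cnj (of_real s * z) * pole w) \<le> s"
    using assms \<rho> mult_left_le[of \<rho> s] by (simp add: norm_mult)
  then have "1 - s \<le> cmod (1 - cnj (of_real s * z) * pole w)"
    using norm_triangle_ineq2[of 1 "cnj (of_real s * z) * pole w"] by simp
  then show ?thesis using s by (simp add: szego_kernel_def norm_divide frac_le)
qed

text \<open>Cauchy-Schwarz in \<open>L\<^sup>2(\<mu>)\<close> between \<open>w \<mapsto> f(\<rho> w)\<close> and \<open>w \<mapsto> 1 / (1 - s \<rho> cnj z w)\<close>: the Schwarz lemma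
  bounds the first norm by the weighted norm of \<open>f\<close>, and the square of the second is a multiple of the
  smoothed weight.\<close>

lemma poisson_hankel_bound:
  assumes f: "f \<in> H2_0" and s: "0 \<le> s" "s < 1" and z: "cmod z = 1"
  shows "(1 - s\<^sup>2 * \<rho>\<^sup>2) * (cmod (poisson_fun s (hankel (\<lambda>w. complex_of_real (\<phi> w)) f) z))\<^sup>2 \<le>
    \<rho>\<^sup>2 * (LINT u|haar. (cmod (f u))\<^sup>2 * \<phi> u) * poisson_fun s \<phi> z"
proof -
  define Q where "Q w = szego_kernel (cnj (of_real s * z)) (pole w)" for w
  define A where "A = (LINT w|\<mu>. (cmod (pole_value f w))\<^sup>2)"
  define C where "C = (LINT w|\<mu>. (cmod (Q w))\<^sup>2)"
  define W where "W = (LINT u|haar. (cmod (f u))\<^sup>2 * \<phi> u)"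
  have fL: "f \<in> L2" using f by (auto simp: H2_0_def H2_def)
  have Qm: "Q \<in> borel_measurable \<mu>"
    unfolding Q_def[abs_def] szego_kernel_def by (rule borel_measurable_circle[OF sets_\<mu>]) measurable
  have Qint: "integrable \<mu> (\<lambda>w. (cmod (Q w))\<^sup>2)"
  proof (rule integrable_const_bound[of _ "(1 / (1 - s))\<^sup>2"])
    show "AE w in \<mu>. norm ((cmod (Q w))\<^sup>2) \<le> (1 / (1 - s))\<^sup>2"
      unfolding Q_def using szego_kernel_pole_bound[OF s z]
      by (intro AE_I2) (auto simp: space_\<mu> intro!: power_mono)
  qed (use Qm in measurable)
  have C0: "0 \<le> C" unfolding C_def by (intro integral_nonneg_AE) simp
  have pos: "0 \<le> 1 - s\<^sup>2 * \<rho>\<^sup>2"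
  proof -
    have "(s * \<rho>)\<^sup>2 \<le> 1\<^sup>2" using s \<rho> by (intro power_mono mult_le_one) auto
    then show ?thesis by (simp add: power_mult_distrib)
  qed
  have X: "poisson_fun s (hankel (\<lambda>w. complex_of_real (\<phi> w)) f) z = (LINT w|\<mu>. pole_value f w * Q w) / (2 * pi)"
    unfolding Q_def by (rule poisson_fun_hankel[OF f s z])
  have Y: "poisson_fun s \<phi> z = (1 - s\<^sup>2 * \<rho>\<^sup>2) * C / (2 * pi)"
    unfolding C_def Q_def by (rule poisson_fun_weight[OF s z])
  have "(cmod (LINT w|\<mu>. pole_value f w * Q w))\<^sup>2 \<le> A * C"
    unfolding A_def C_def
    by (rule Cauchy_Schwarz_integral[OF pole_value_measurable[OF fL] Qm integral_pole_value_bound(1)[OF f] Qint])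
  also have "\<dots> \<le> (2 * pi * \<rho>\<^sup>2 * W) * C"
    unfolding A_def W_def by (rule mult_right_mono[OF integral_pole_value_bound(2)[OF f] C0])
  finally have "(cmod (LINT w|\<mu>. pole_value f w * Q w))\<^sup>2 / (2 * pi)\<^sup>2 \<le> (2 * pi * \<rho>\<^sup>2 * W) * C / (2 * pi)\<^sup>2"
    by (rule divide_right_mono) simp
  then have "(cmod (poisson_fun s (hankel (\<lambda>w. complex_of_real (\<phi> w)) f) z))\<^sup>2 \<le> \<rho>\<^sup>2 * W * C / (2 * pi)"
  proof -
    have "(2 * pi * \<rho>\<^sup>2 * W) * C / (2 * pi)\<^sup>2 = \<rho>\<^sup>2 * W * C / (2 * pi)"
      by (simp add: power2_eq_square)
    moreover have "cmod (complex_of_real (2 * pi)) = 2 * pi" by (simp only: norm_of_real) simp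
    ultimately show ?thesis
      using \<open>_ / (2 * pi)\<^sup>2 \<le> _\<close> unfolding X norm_divide power_divide by simp
  qed
  then have "(1 - s\<^sup>2 * \<rho>\<^sup>2) * (cmod (poisson_fun s (hankel (\<lambda>w. complex_of_real (\<phi> w)) f) z))\<^sup>2
      \<le> (1 - s\<^sup>2 * \<rho>\<^sup>2) * (\<rho>\<^sup>2 * W * C / (2 * pi))"
    by (rule mult_left_mono[OF _ pos])
  then show ?thesis unfolding Y W_def by (simp add: mult_ac)
qed

text \<open>The essential supremum of a function that is not measurable is \<open>\<infinity>\<close> by convention, so measurability
  is part of the bound. It is read off from the integral formulas over \<open>\<mu>\<close>.\<close>

lemma poisson_fun_measurable:
  assumes f: "f \<in> H2_0" and s: "0 \<le> s" "s < 1"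
  shows "poisson_fun s (hankel (\<lambda>w. complex_of_real (\<phi> w)) f) \<in> borel_measurable haar"
    and "poisson_fun s \<phi> \<in> borel_measurable haar"
proof -
  have fL: "f \<in> L2" using f by (auto simp: H2_0_def H2_def)
  note [measurable] = pole_value_measurable[OF fL]
  define B where "B = (LINT u|haar. 1 / (1 - \<rho>)\<^sup>2 * cmod (f u))"
  let ?q = "\<lambda>z w. szego_kernel (cnj (of_real s * z)) (pole w)"
  have "integrable haar (\<lambda>z. LINT w|\<mu>. pole_value f w * ?q z w)"
  proof (rule Fubini_dominated(3)[OF finite_measure_axioms haar.finite_measure_axioms])
    show "(\<lambda>(w, z). pole_value f w * ?q z w) \<in> borel_measurable (\<mu> \<Otimes>\<^sub>M haar)"
      unfolding szego_kernel_def case_prod_beta by measurable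
    show "integrable haar (\<lambda>_. B * (1 / (1 - s)))" by simp
    fix w z assume "w \<in> space \<mu>" "z \<in> space haar"
    then show "norm (pole_value f w * ?q z w) \<le> B * (1 / (1 - s))"
      unfolding norm_mult B_def using pole_value_bound[OF fL, of w] szego_kernel_pole_bound[OF s, of z w]
      by (intro mult_mono) (auto simp: space_\<mu> intro!: integral_nonneg_AE)
  qed
  then have "(\<lambda>z. (LINT w|\<mu>. pole_value f w * ?q z w) / (2 * pi)) \<in> borel_measurable haar"
    by measurable
  moreover have "(\<lambda>z. (LINT w|\<mu>. pole_value f w * ?q z w) / (2 * pi)) \<in> borel_measurable haar \<longleftrightarrow>
      poisson_fun s (hankel (\<lambda>w. complex_of_real (\<phi> w)) f) \<in> borel_measurable haar"
    by (rule measurable_cong) (simp add: poisson_fun_hankel[OF f s])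
  ultimately show "poisson_fun s (hankel (\<lambda>w. complex_of_real (\<phi> w)) f) \<in> borel_measurable haar"
    by blast
  have "integrable haar (\<lambda>z. LINT w|\<mu>. (cmod (?q z w))\<^sup>2)"
  proof (rule Fubini_dominated(3)[OF finite_measure_axioms haar.finite_measure_axioms])
    show "(\<lambda>(w, z). (cmod (?q z w))\<^sup>2) \<in> borel_measurable (\<mu> \<Otimes>\<^sub>M haar)"
      unfolding szego_kernel_def case_prod_beta by measurable
    show "integrable haar (\<lambda>_. (1 / (1 - s))\<^sup>2)" by simp
    fix w z assume "w \<in> space \<mu>" "z \<in> space haar"
    then show "norm ((cmod (?q z w))\<^sup>2) \<le> (1 / (1 - s))\<^sup>2"
      using power_mono[OF szego_kernel_pole_bound[OF s, of z w], of 2] by (simp add: space_\<mu>)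
  qed
  then have "(\<lambda>z. (1 - s\<^sup>2 * \<rho>\<^sup>2) * (LINT w|\<mu>. (cmod (?q z w))\<^sup>2) / (2 * pi)) \<in> borel_measurable haar"
    by measurable
  moreover have "(\<lambda>z. (1 - s\<^sup>2 * \<rho>\<^sup>2) * (LINT w|\<mu>. (cmod (?q z w))\<^sup>2) / (2 * pi)) \<in> borel_measurable haar \<longleftrightarrow>
      poisson_fun s \<phi> \<in> borel_measurable haar"
    by (rule measurable_cong) (simp add: poisson_fun_weight[OF s])
  ultimately show "poisson_fun s \<phi> \<in> borel_measurable haar" by blast
qed

end

section \<open>The bound in the supremum norm\<close>

theorem proposition1p14:
  fixes \<mu> :: "complex measure" and \<phi> :: "complex \<Rightarrow> real" and f :: "complex \<Rightarrow> complex"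
  assumes "finite_measure \<mu>" and "sets \<mu> = sets circle_borel"
    and "\<forall>z \<in> sphere 0 1. \<phi> z = poisson_measure (sqrt (2 / 3)) \<mu> z"
    and "\<exists>z \<in> sphere 0 1. \<phi> z \<noteq> 0"
    and "f \<in> H2_0"
  shows "Linf_norm (\<lambda>z. poisson_fun (1 / sqrt 2) (hankel (\<lambda>w. complex_of_real (\<phi> w)) f) z
             / complex_of_real (sqrt (poisson_fun (1 / sqrt 2) \<phi> z)))
         \<le> ereal (weighted_L2_norm \<phi> f)"
proof -
  let ?X = "poisson_fun (1 / sqrt 2) (hankel (\<lambda>w. complex_of_real (\<phi> w)) f)"
  let ?Y = "poisson_fun (1 / sqrt 2) \<phi>"
  define W where "W = (LINT u|haar. (cmod (f u))\<^sup>2 * \<phi> u)"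
  interpret poisson_weight \<mu> "sqrt (2 / 3)" \<phi>
    using assms by (intro poisson_weight.intro poisson_weight_axioms.intro) auto
  have s: "0 \<le> 1 / sqrt 2" "1 / sqrt 2 < (1 :: real)" by simp_all
  note [measurable] = poisson_fun_measurable[OF \<open>f \<in> H2_0\<close> s]
  have m: "(\<lambda>z. ereal (cmod (?X z / complex_of_real (sqrt (?Y z))))) \<in> borel_measurable haar"
    by measurable
  have "cmod (?X z / complex_of_real (sqrt (?Y z))) \<le> sqrt W" if z: "cmod z = 1" for z
  proof -
    \<comment> \<open>With \<open>\<rho>\<^sup>2 = 2/3\<close> and \<open>s\<^sup>2 = 1/2\<close> the factors \<open>1 - s\<^sup>2 \<rho>\<^sup>2\<close> and \<open>\<rho>\<^sup>2\<close> are equal and cancel.\<close>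
    have "(cmod (?X z))\<^sup>2 \<le> W * ?Y z"
      using poisson_hankel_bound[OF \<open>f \<in> H2_0\<close> s z]
      by (simp add: W_def power_divide)
    then have "cmod (?X z) \<le> sqrt W * sqrt (?Y z)"
      by (metis real_le_rsqrt real_sqrt_mult)
    moreover have "0 \<le> ?Y z"
      unfolding poisson_fun_weight[OF s z]
      by (intro divide_nonneg_pos mult_nonneg_nonneg integral_nonneg_AE) (auto simp: power_divide)
    moreover have "0 \<le> W" unfolding W_def using weight_nonneg by (intro integral_nonneg_AE AE_I2) simp
    \<comment> \<open>Where the denominator vanishes, the quotient is \<open>0\<close> by convention.\<close>
    ultimately show ?thesis
      by (cases "?Y z = 0") (simp_all add: norm_divide divide_le_eq)
  qed
  then have "AE z in haar. ereal (cmod (?X z / complex_of_real (sqrt (?Y z)))) \<le> ereal (sqrt W)"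
    by (intro AE_I2) simp
  with m show ?thesis
    unfolding Linf_norm_def esssup_def weighted_L2_norm_def W_def[symmetric]
    by (simp add: Limsup_bounded)
qed

end
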